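(* Let $r\ge 1$ and let $W=\sum_{i=1}^n \gamma_i x^{v_i}$ be a Laurent polynomial in $x_1,\dots,x_r$ (with $v_i\in\mathbb Z^r$ distinct and $x^{v}=x_1^{v_1}\cdots x_r^{v_r}$) satisfying the following two properties. (1) (positivity) The coefficients $\gamma_i$ lie in $\mathbf K_{>0}$. (2) (completeness) The Newton polytope of $W$, that is, the convex hull of $\{v_1,\dots,v_n\}$ in $\mathbb R^r$, is full-dimensional with $0$ in its interior. Then $W$ has a unique critical point in $(\mathbf K_{>0})^r$.
   Context: $\mathbf K$ is the field of generalised Puiseux series: series $c(t)=\sum_{k} c_{\mu_k}t^{\mu_k}$ with $c_{\mu_k}\in\mathbb C$, where the real exponents $\mu_0<\mu_1<\mu_2<\cdots$ form a strictly increasing sequence that is either finite or tends to $+\infty$. $\mathbf K_{>0}\subset\mathbf K$ is the set of nonzero series whose leading coefficient (the coefficient of the lowest-order nonvanishing term) is a positive real number. A critical point of $W$ in $(\mathbf K_{>0})^r$ is a point at which all the partial derivatives $\partial W/\partial x_j$, $j=1,\dots,r$, vanish. *)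

theory Defs
  imports "HOL-Analysis.Analysis" "HOL-Library.Poly_Mapping"
begin

section \<open>Generalised Puiseux series\<close>

text \<open>The support is finite, or it is enumerated by a strictly increasing sequence of reals
  tending to \<open>+\<infinity>\<close>.\<close>

definition puiseux_support :: "real set \<Rightarrow> bool" where
  "puiseux_support S \<longleftrightarrow>
     finite S \<or> (\<exists>\<mu> :: nat \<Rightarrow> real. strict_mono \<mu> \<and> filterlim \<mu> at_top sequentially \<and> S = range \<mu>)"

lemma puiseux_support_iff: "puiseux_support S \<longleftrightarrow> (\<forall>B. finite {s \<in> S. s \<le> B})"
proof
  assume "puiseux_support S"
  then consider "finite S"
    | \<mu> where "strict_mono \<mu>" "filterlim \<mu> at_top sequentially" "S = range \<mu>"
    unfolding puiseux_support_def by blast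
  then show "\<forall>B. finite {s \<in> S. s \<le> B}"
  proof cases
    case 1
    then show ?thesis by simp
  next
    case 2
    show ?thesis
    proof
      fix B
      from 2(2) have "eventually (\<lambda>n. \<mu> n > B) sequentially"
        by (simp add: filterlim_at_top_dense)
      then obtain N where N: "\<And>n. n \<ge> N \<Longrightarrow> \<mu> n > B"
        by (auto simp: eventually_sequentially)
      have "{s \<in> S. s \<le> B} \<subseteq> \<mu> ` {..<N}"
        using N 2(3) by (force simp: not_less[symmetric])
      then show "finite {s \<in> S. s \<le> B}"
        by (rule finite_subset) simp
    qed
  qed
next
  assume fin: "\<forall>B. finite {s \<in> S. s \<le> B}"
  show "puiseux_support S"
  proof (cases "finite S")
    case True
    then show ?thesis by (simp add: puiseux_support_def)
  next
    case False
    have least: "\<exists>m\<in>T. \<forall>s\<in>T. m \<le> s" if T: "T \<subseteq> S" "T \<noteq> {}" for T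
    proof -
      from T obtain t where t: "t \<in> T" by blast
      let ?F = "{s \<in> T. s \<le> t}"
      have F: "finite ?F"
        by (rule finite_subset[OF _ fin[rule_format, of t]]) (use T in auto)
      moreover have "?F \<noteq> {}" using t by auto
      ultimately have "Min ?F \<in> ?F" by (rule Min_in)
      moreover have "Min ?F \<le> s" if "s \<in> T" for s
      proof (cases "s \<le> t")
        case True
        then show ?thesis using F that by (intro Min_le) auto
      next
        case False
        then show ?thesis using \<open>Min ?F \<in> ?F\<close> by auto
      qed
      ultimately show ?thesis by blast
    qed
    have ne: "{s \<in> S. s > B} \<noteq> {}" for B
    proof
      assume "{s \<in> S. s > B} = {}"
      then have "S = {s \<in> S. s \<le> B}" by force
      then show False using False fin by metis
    qed
    define P where "P n m \<longleftrightarrow> m \<in> S \<and> (n = (0::nat) \<longrightarrow> (\<forall>s\<in>S. m \<le> s))" for n m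
    define Q where "Q m m' \<longleftrightarrow> m < m' \<and> (\<forall>s\<in>S. s > m \<longrightarrow> m' \<le> s)" for m m' :: real
    have "\<exists>f. \<forall>n. P n (f n) \<and> Q (f n) (f (Suc n))"
    proof (rule dependent_nat_choice)
      show "\<exists>x. P 0 x" using least[of S] False unfolding P_def by auto
    next
      fix x and n :: nat
      assume "P n x"
      show "\<exists>y. P (Suc n) y \<and> Q x y"
        using least[OF _ ne[of x]] unfolding P_def Q_def by auto
    qed
    then obtain \<mu> where \<mu>: "\<And>n. P n (\<mu> n)" "\<And>n. Q (\<mu> n) (\<mu> (Suc n))" by blast
    have mono: "strict_mono \<mu>"
      using \<mu>(2) by (auto simp: strict_mono_Suc_iff Q_def)
    have inS: "\<mu> n \<in> S" for n using \<mu>(1) by (auto simp: P_def)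
    have lim: "filterlim \<mu> at_top sequentially"
      unfolding filterlim_at_top_dense
    proof
      fix B
      have "finite (\<mu> -` {s \<in> S. s \<le> B})"
        by (rule finite_vimageI) (use fin mono in \<open>auto intro: strict_mono_imp_inj_on\<close>)
      then obtain n where "n \<notin> \<mu> -` {s \<in> S. s \<le> B}"
        using ex_new_if_finite infinite_UNIV_nat by blast
      then have "\<mu> n > B" using inS by auto
      then have "\<mu> m > B" if "m \<ge> n" for m
        using strict_mono_mono[OF mono] that by (meson less_le_trans monoD)
      then show "eventually (\<lambda>n. B < \<mu> n) sequentially"
        by (auto simp: eventually_sequentially)
    qed
    have "S \<subseteq> range \<mu>"
    proof
      fix s assume s: "s \<in> S"
      have "\<exists>n. \<mu> n > s"
        using lim by (auto simp: filterlim_at_top_dense eventually_sequentially)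
      define n where "n = (LEAST n. \<mu> n > s)"
      have n: "\<mu> n > s" unfolding n_def using \<open>\<exists>n. \<mu> n > s\<close> by (rule LeastI_ex)
      have "n \<noteq> 0"
      proof
        assume "n = 0"
        then show False using n \<mu>(1)[of 0] s by (auto simp: P_def)
      qed
      then obtain m where m: "n = Suc m" using not0_implies_Suc by blast
      have "\<not> \<mu> m > s" using not_less_Least[of m "\<lambda>n. \<mu> n > s"] m n_def by simp
      moreover have "\<not> \<mu> m < s" using \<mu>(2)[of m] s n m by (auto simp: Q_def)
      ultimately show "s \<in> range \<mu>" by (metis linorder_less_linear rangeI)
    qed
    then show ?thesis using mono lim inS unfolding puiseux_support_def by blast
  qed
qed

typedef puiseux = "{c :: real \<Rightarrow> complex. puiseux_support {\<mu>. c \<mu> \<noteq> 0}}"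
  morphisms puiseux_coeff Abs_puiseux
  by (rule exI[of _ "\<lambda>_. 0"]) (simp add: puiseux_support_def)

setup_lifting type_definition_puiseux

lemma puiseux_eqI: "(\<And>\<mu>. puiseux_coeff x \<mu> = puiseux_coeff y \<mu>) \<Longrightarrow> x = y"
  by (metis ext puiseux_coeff_inject)

lemma finite_puiseux_coeff: "finite {\<mu>. puiseux_coeff x \<mu> \<noteq> 0 \<and> \<mu> \<le> B}"
  using puiseux_coeff[of x] by (simp add: puiseux_support_iff)

lemma puiseux_support_bounded:
  assumes "puiseux_support {\<mu>. c \<mu> \<noteq> 0}"
  shows "\<exists>l. \<forall>\<mu><l. c \<mu> = (0::complex)"
proof -
  have F: "finite {\<mu>. c \<mu> \<noteq> 0 \<and> \<mu> \<le> 0}"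
    using assms by (simp add: puiseux_support_iff)
  define l where "l = Min (insert 0 {\<mu>. c \<mu> \<noteq> 0 \<and> \<mu> \<le> 0})"
  have l0: "l \<le> 0" unfolding l_def using F by (intro Min_le) auto
  have "c \<mu> = 0" if "\<mu> < l" for \<mu>
  proof (rule ccontr)
    assume "c \<mu> \<noteq> 0"
    then have "\<mu> \<in> insert 0 {\<mu>. c \<mu> \<noteq> 0 \<and> \<mu> \<le> 0}" using l0 that by simp
    then have "l \<le> \<mu>" unfolding l_def using F by (intro Min_le) auto
    then show False using that by simp
  qed
  then show ?thesis by blast
qed

lemma puiseux_coeff_bounded: "\<exists>l. \<forall>\<mu><l. puiseux_coeff x \<mu> = 0"
  using puiseux_support_bounded puiseux_coeff[of x] by blast

instantiation puiseux :: comm_ring_1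
begin

lift_definition zero_puiseux :: puiseux is "\<lambda>_. 0"
  by (simp add: puiseux_support_def)

lift_definition one_puiseux :: puiseux is "\<lambda>\<mu>. if \<mu> = 0 then 1 else 0"
  by (simp add: puiseux_support_def)

lift_definition uminus_puiseux :: "puiseux \<Rightarrow> puiseux" is "\<lambda>x \<mu>. - x \<mu>"
  by simp

lift_definition plus_puiseux :: "puiseux \<Rightarrow> puiseux \<Rightarrow> puiseux" is "\<lambda>x y \<mu>. x \<mu> + y \<mu>"
proof -
  fix x y :: "real \<Rightarrow> complex"
  assume *: "puiseux_support {\<mu>. x \<mu> \<noteq> 0}" "puiseux_support {\<mu>. y \<mu> \<noteq> 0}"
  show "puiseux_support {\<mu>. x \<mu> + y \<mu> \<noteq> 0}"
    unfolding puiseux_support_iff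
  proof
    fix B
    have "finite ({\<mu>. x \<mu> \<noteq> 0 \<and> \<mu> \<le> B} \<union> {\<mu>. y \<mu> \<noteq> 0 \<and> \<mu> \<le> B})"
      using * by (simp add: puiseux_support_iff)
    then show "finite {\<mu> \<in> {\<mu>. x \<mu> + y \<mu> \<noteq> 0}. \<mu> \<le> B}"
      by (rule finite_subset[rotated]) auto
  qed
qed

definition minus_puiseux :: "puiseux \<Rightarrow> puiseux \<Rightarrow> puiseux" where
  "minus_puiseux x y = x + - y"

text \<open>The index set of the sum is finite, because both supports are left-finite.\<close>

lift_definition times_puiseux :: "puiseux \<Rightarrow> puiseux \<Rightarrow> puiseux" is
  "\<lambda>x y \<mu>. \<Sum>\<alpha> | x \<alpha> \<noteq> 0 \<and> y (\<mu> - \<alpha>) \<noteq> 0. x \<alpha> * y (\<mu> - \<alpha>)"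
proof -
  fix x y :: "real \<Rightarrow> complex"
  assume *: "puiseux_support {\<mu>. x \<mu> \<noteq> 0}" "puiseux_support {\<mu>. y \<mu> \<noteq> 0}"
  obtain l where l: "\<And>\<mu>. \<mu> < l \<Longrightarrow> x \<mu> = 0" using puiseux_support_bounded[OF *(1)] by blast
  obtain m where m: "\<And>\<mu>. \<mu> < m \<Longrightarrow> y \<mu> = 0" using puiseux_support_bounded[OF *(2)] by blast
  show "puiseux_support {\<mu>. (\<Sum>\<alpha> | x \<alpha> \<noteq> 0 \<and> y (\<mu> - \<alpha>) \<noteq> 0. x \<alpha> * y (\<mu> - \<alpha>)) \<noteq> 0}"
    unfolding puiseux_support_iff
  proof
    fix B
    let ?A = "{\<alpha>. x \<alpha> \<noteq> 0 \<and> \<alpha> \<le> B - m}" and ?B = "{\<beta>. y \<beta> \<noteq> 0 \<and> \<beta> \<le> B - l}"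
    have "finite ((\<lambda>(\<alpha>, \<beta>). \<alpha> + \<beta>) ` (?A \<times> ?B))"
      using * by (intro finite_imageI finite_cartesian_product) (simp_all add: puiseux_support_iff)
    moreover have "{\<mu> \<in> {\<mu>. (\<Sum>\<alpha> | x \<alpha> \<noteq> 0 \<and> y (\<mu> - \<alpha>) \<noteq> 0. x \<alpha> * y (\<mu> - \<alpha>)) \<noteq> 0}. \<mu> \<le> B}
        \<subseteq> (\<lambda>(\<alpha>, \<beta>). \<alpha> + \<beta>) ` (?A \<times> ?B)"
    proof
      fix \<mu> assume "\<mu> \<in> {\<mu> \<in> {\<mu>. (\<Sum>\<alpha> | x \<alpha> \<noteq> 0 \<and> y (\<mu> - \<alpha>) \<noteq> 0. x \<alpha> * y (\<mu> - \<alpha>)) \<noteq> 0}. \<mu> \<le> B}"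
      then have \<mu>: "\<mu> \<le> B" "(\<Sum>\<alpha> | x \<alpha> \<noteq> 0 \<and> y (\<mu> - \<alpha>) \<noteq> 0. x \<alpha> * y (\<mu> - \<alpha>)) \<noteq> 0" by auto
      then obtain \<alpha> where \<alpha>: "x \<alpha> \<noteq> 0" "y (\<mu> - \<alpha>) \<noteq> 0"
        by (auto elim!: sum.not_neutral_contains_not_neutral)
      have "l \<le> \<alpha>" "m \<le> \<mu> - \<alpha>" using \<alpha> l m by (meson not_le)+
      then have "(\<alpha>, \<mu> - \<alpha>) \<in> ?A \<times> ?B" using \<alpha> \<mu>(1) by auto
      then show "\<mu> \<in> (\<lambda>(\<alpha>, \<beta>). \<alpha> + \<beta>) ` (?A \<times> ?B)" by (intro image_eqI) auto
    qed
    ultimately show "finite {\<mu> \<in> {\<mu>. (\<Sum>\<alpha> | x \<alpha> \<noteq> 0 \<and> y (\<mu> - \<alpha>) \<noteq> 0. x \<alpha> * y (\<mu> - \<alpha>)) \<noteq> 0}. \<mu> \<le> B}"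
      by (rule finite_subset[rotated])
  qed
qed

lemma puiseux_coeff_times:
  assumes "finite F" "\<And>\<alpha>. puiseux_coeff x \<alpha> \<noteq> 0 \<Longrightarrow> puiseux_coeff y (\<mu> - \<alpha>) \<noteq> 0 \<Longrightarrow> \<alpha> \<in> F"
  shows "puiseux_coeff (x * y) \<mu> = (\<Sum>\<alpha>\<in>F. puiseux_coeff x \<alpha> * puiseux_coeff y (\<mu> - \<alpha>))"
  unfolding times_puiseux.rep_eq
  by (rule sum.mono_neutral_left) (use assms in auto)

lemma puiseux_coeff_times_eq_0:
  assumes "\<forall>\<mu><l. puiseux_coeff x \<mu> = 0" "\<forall>\<mu><m. puiseux_coeff y \<mu> = 0" "\<mu> < l + m"
  shows "puiseux_coeff (x * y) \<mu> = 0"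
  unfolding times_puiseux.rep_eq
proof (rule sum.neutral, clarify)
  fix \<alpha> assume "puiseux_coeff x \<alpha> \<noteq> 0" "puiseux_coeff y (\<mu> - \<alpha>) \<noteq> 0"
  then have "l \<le> \<alpha>" "m \<le> \<mu> - \<alpha>" using assms by (meson not_le)+
  then show "puiseux_coeff x \<alpha> * puiseux_coeff y (\<mu> - \<alpha>) = 0" using assms(3) by simp
qed

instance
proof
  fix a b c :: puiseux
  note [simp] = plus_puiseux.rep_eq zero_puiseux.rep_eq uminus_puiseux.rep_eq one_puiseux.rep_eq
  show "a + b + c = a + (b + c)" by (rule puiseux_eqI) simp
  show "a + b = b + a" by (rule puiseux_eqI) simp
  show "0 + a = a" by (rule puiseux_eqI) simp
  show "- a + a = 0" by (rule puiseux_eqI) simp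
  show "a - b = a + - b" by (rule minus_puiseux_def)
  have comm: "x * y = y * x" for x y :: puiseux
  proof (rule puiseux_eqI)
    fix \<mu>
    show "puiseux_coeff (x * y) \<mu> = puiseux_coeff (y * x) \<mu>"
      unfolding times_puiseux.rep_eq
      by (rule sum.reindex_bij_witness[of _ "\<lambda>\<alpha>. \<mu> - \<alpha>" "\<lambda>\<alpha>. \<mu> - \<alpha>"]) auto
  qed
  show "a * b = b * a" by (rule comm)
  show "1 * a = a"
  proof (rule puiseux_eqI)
    fix \<mu>
    have "puiseux_coeff (1 * a) \<mu> = (\<Sum>\<alpha>\<in>{0}. puiseux_coeff 1 \<alpha> * puiseux_coeff a (\<mu> - \<alpha>))"
      by (rule puiseux_coeff_times) (auto split: if_splits)
    then show "puiseux_coeff (1 * a) \<mu> = puiseux_coeff a \<mu>" by simp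
  qed
  show "(0::puiseux) \<noteq> 1"
    by (metis one_puiseux.rep_eq zero_puiseux.rep_eq zero_neq_one)
  have bnd: "\<mu> \<ge> l" if "\<forall>\<mu><l. puiseux_coeff x \<mu> = 0" "puiseux_coeff x \<mu> \<noteq> 0" for x \<mu> l
    using that by (meson not_le)
  obtain la where la: "\<forall>\<mu><la. puiseux_coeff a \<mu> = 0" using puiseux_coeff_bounded[of a] by blast
  obtain lb where lb: "\<forall>\<mu><lb. puiseux_coeff b \<mu> = 0" using puiseux_coeff_bounded[of b] by blast
  obtain lc where lc: "\<forall>\<mu><lc. puiseux_coeff c \<mu> = 0" using puiseux_coeff_bounded[of c] by blast
  show "(a + b) * c = a * c + b * c"
  proof (rule puiseux_eqI)
    fix \<mu>
    let ?F = "{\<alpha>. puiseux_coeff a \<alpha> \<noteq> 0 \<and> \<alpha> \<le> \<mu> - lc} \<union> {\<alpha>. puiseux_coeff b \<alpha> \<noteq> 0 \<and> \<alpha> \<le> \<mu> - lc}"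
    have F: "finite ?F" using finite_puiseux_coeff by auto
    have *: "puiseux_coeff (x * c) \<mu> = (\<Sum>\<alpha>\<in>?F. puiseux_coeff x \<alpha> * puiseux_coeff c (\<mu> - \<alpha>))"
      if "x = a \<or> x = b \<or> x = a + b" for x
      by (rule puiseux_coeff_times[OF F]) (use that in \<open>auto dest!: bnd[OF lc]\<close>)
    show "puiseux_coeff ((a + b) * c) \<mu> = puiseux_coeff (a * c + b * c) \<mu>"
      by (simp add: * sum.distrib algebra_simps del: Un_iff)
  qed
  show "a * b * c = a * (b * c)"
  proof (rule puiseux_eqI)
    fix \<mu>
    let ?A = "{\<alpha>. puiseux_coeff a \<alpha> \<noteq> 0 \<and> \<alpha> \<le> \<mu> - lb - lc}"
    let ?C = "{\<alpha>. puiseux_coeff c \<alpha> \<noteq> 0 \<and> \<alpha> \<le> \<mu> - lb - la}"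
    have fin: "finite ?A" "finite ?C" by (rule finite_puiseux_coeff)+
    have lt: "\<nu> \<ge> l + m" if "puiseux_coeff (x * y) \<nu> \<noteq> 0"
      "\<forall>\<mu><l. puiseux_coeff x \<mu> = 0" "\<forall>\<mu><m. puiseux_coeff y \<mu> = 0" for x y \<nu> l m
      using puiseux_coeff_times_eq_0 that by (meson not_le)
    have "puiseux_coeff (a * b * c) \<mu> = puiseux_coeff (c * (a * b)) \<mu>"
      by (simp add: comm)
    also have "\<dots> = (\<Sum>\<gamma>\<in>?C. puiseux_coeff c \<gamma> * puiseux_coeff (a * b) (\<mu> - \<gamma>))"
      by (rule puiseux_coeff_times[OF fin(2)]) (auto dest!: lt[OF _ la lb])
    also have "\<dots> = (\<Sum>\<gamma>\<in>?C. puiseux_coeff c \<gamma> *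
        (\<Sum>\<alpha>\<in>?A. puiseux_coeff a \<alpha> * puiseux_coeff b (\<mu> - \<gamma> - \<alpha>)))"
    proof (rule sum.cong[OF refl])
      fix \<gamma> assume "\<gamma> \<in> ?C"
      then have "\<gamma> \<ge> lc" using bnd[OF lc] by blast
      then show "puiseux_coeff c \<gamma> * puiseux_coeff (a * b) (\<mu> - \<gamma>) = puiseux_coeff c \<gamma> *
        (\<Sum>\<alpha>\<in>?A. puiseux_coeff a \<alpha> * puiseux_coeff b (\<mu> - \<gamma> - \<alpha>))"
        by (subst puiseux_coeff_times[OF fin(1)]) (auto dest!: bnd[OF lb])
    qed
    also have "\<dots> = (\<Sum>\<alpha>\<in>?A. puiseux_coeff a \<alpha> *
        (\<Sum>\<gamma>\<in>?C. puiseux_coeff c \<gamma> * puiseux_coeff b (\<mu> - \<alpha> - \<gamma>)))"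
      unfolding sum_distrib_left
      by (subst sum.swap) (simp add: algebra_simps)
    also have "\<dots> = (\<Sum>\<alpha>\<in>?A. puiseux_coeff a \<alpha> * puiseux_coeff (c * b) (\<mu> - \<alpha>))"
    proof (rule sum.cong[OF refl])
      fix \<alpha> assume "\<alpha> \<in> ?A"
      then have "\<alpha> \<ge> la" using bnd[OF la] by blast
      then show "puiseux_coeff a \<alpha> * (\<Sum>\<gamma>\<in>?C. puiseux_coeff c \<gamma> * puiseux_coeff b (\<mu> - \<alpha> - \<gamma>)) =
          puiseux_coeff a \<alpha> * puiseux_coeff (c * b) (\<mu> - \<alpha>)"
        by (subst puiseux_coeff_times[OF fin(2)]) (auto dest!: bnd[OF lb])
    qed
    also have "\<dots> = puiseux_coeff (a * (c * b)) \<mu>"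
      by (rule puiseux_coeff_times[OF fin(1), symmetric]) (auto dest!: lt[OF _ lc lb])
    also have "\<dots> = puiseux_coeff (a * (b * c)) \<mu>" by (simp add: comm)
    finally show "puiseux_coeff (a * b * c) \<mu> = puiseux_coeff (a * (b * c)) \<mu>" .
  qed
qed

end

lemma puiseux_least_exponent:
  assumes "x \<noteq> 0"
  shows "\<exists>a. puiseux_coeff x a \<noteq> 0 \<and> (\<forall>\<mu><a. puiseux_coeff x \<mu> = 0)"
proof -
  obtain b where b: "puiseux_coeff x b \<noteq> 0"
    using assms by (metis puiseux_eqI zero_puiseux.rep_eq)
  let ?F = "{\<mu>. puiseux_coeff x \<mu> \<noteq> 0 \<and> \<mu> \<le> b}"
  have F: "finite ?F" "?F \<noteq> {}" using finite_puiseux_coeff b by auto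
  have "Min ?F \<in> ?F" using F by (rule Min_in)
  moreover have "puiseux_coeff x \<mu> = 0" if "\<mu> < Min ?F" for \<mu>
  proof (rule ccontr)
    assume "puiseux_coeff x \<mu> \<noteq> 0"
    then have "\<mu> \<in> ?F" using that \<open>Min ?F \<in> ?F\<close> by auto
    then show False using Min_le[OF F(1)] that by fastforce
  qed
  ultimately show ?thesis by blast
qed

lift_definition puiseux_monom :: "complex \<Rightarrow> real \<Rightarrow> puiseux" is
  "\<lambda>c a \<mu>. if \<mu> = a then c else 0"
  by (simp add: puiseux_support_def)

lemma puiseux_coeff_monom_times:
  "puiseux_coeff (puiseux_monom c a * x) \<mu> = c * puiseux_coeff x (\<mu> - a)"
  by (subst puiseux_coeff_times[of "{a}"]) (auto simp: puiseux_monom.rep_eq split: if_splits)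

lemma puiseux_coeff_diff: "puiseux_coeff (x - y) \<mu> = puiseux_coeff x \<mu> - puiseux_coeff y \<mu>"
  by (simp add: minus_puiseux_def plus_puiseux.rep_eq uminus_puiseux.rep_eq
      del: add_uminus_conv_diff)

lemma puiseux_geometric:
  assumes d: "d > 0" and z: "\<forall>\<mu><d. puiseux_coeff z \<mu> = 0"
  shows "\<exists>g. (1 - z) * g = 1"
proof -
  have pow: "\<forall>\<mu> < real k * d. puiseux_coeff (z ^ k) \<mu> = 0" for k
  proof (induction k)
    case 0
    then show ?case by (auto simp: one_puiseux.rep_eq)
  next
    case (Suc k)
    then show ?case
      using puiseux_coeff_times_eq_0[OF z Suc] by (simp add: distrib_right)
  qed
  define P where "P n = (\<Sum>k<n. z ^ k)" for n
  have stable: "puiseux_coeff (P m) \<mu> = puiseux_coeff (P n) \<mu>" if "n \<le> m" "\<mu> < real n * d" for m n \<mu>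
    using that(1)
  proof (induction m rule: dec_induct)
    case (step m)
    have "\<mu> < real m * d"
      using that(2) step(1) d by (meson less_le_trans mult_right_mono of_nat_le_iff less_imp_le)
    then have "puiseux_coeff (z ^ m) \<mu> = 0" using pow by blast
    then show ?case using step by (simp add: P_def plus_puiseux.rep_eq)
  qed simp
  define N where "N \<mu> = nat (\<lfloor>\<mu> / d\<rfloor> + 1)" for \<mu>
  have N: "\<mu> < real (N \<mu>) * d" for \<mu>
  proof -
    have "\<mu> / d < real (N \<mu>)" unfolding N_def by linarith
    then show ?thesis using d by (simp add: pos_divide_less_eq)
  qed
  define c where "c \<mu> = puiseux_coeff (P (N \<mu>)) \<mu>" for \<mu>
  have c: "c \<mu> = puiseux_coeff (P (N B)) \<mu>" if "\<mu> \<le> B" for \<mu> B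
  proof -
    have "\<mu> / d \<le> B / d" using that d by (simp add: divide_right_mono)
    then have "N \<mu> \<le> N B" unfolding N_def by (intro nat_mono add_right_mono floor_mono)
    then show ?thesis unfolding c_def using stable N by simp
  qed
  have supp: "puiseux_support {\<mu>. c \<mu> \<noteq> 0}"
    unfolding puiseux_support_iff
  proof
    fix B
    show "finite {\<mu> \<in> {\<mu>. c \<mu> \<noteq> 0}. \<mu> \<le> B}"
      by (rule finite_subset[OF _ finite_puiseux_coeff[of "P (N B)" B]]) (use c in auto)
  qed
  define g where "g = Abs_puiseux c"
  have g: "puiseux_coeff g = c" unfolding g_def using supp by (simp add: Abs_puiseux_inverse)
  have z1: "puiseux_coeff (1 - z) \<alpha> = 0" if "\<alpha> < 0" for \<alpha>
    using that z d by (simp add: puiseux_coeff_diff one_puiseux.rep_eq)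
  have "(1 - z) * g = 1"
  proof (rule puiseux_eqI)
    fix \<mu>
    have "puiseux_coeff ((1 - z) * g) \<mu> - puiseux_coeff ((1 - z) * P (N \<mu>)) \<mu>
        = puiseux_coeff ((1 - z) * (g - P (N \<mu>))) \<mu>"
      by (simp only: puiseux_coeff_diff right_diff_distrib)
    also have "\<dots> = 0"
      unfolding times_puiseux.rep_eq
    proof (rule sum.neutral, clarify)
      fix \<alpha> assume "puiseux_coeff (1 - z) \<alpha> \<noteq> 0"
      then have "\<mu> - \<alpha> \<le> \<mu>" using z1[of \<alpha>] by (cases "\<alpha> < 0") auto
      then show "puiseux_coeff (1 - z) \<alpha> * puiseux_coeff (g - P (N \<mu>)) (\<mu> - \<alpha>) = 0"
        using c by (simp add: puiseux_coeff_diff g)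
    qed
    also have "(1 - z) * P (N \<mu>) = 1 - z ^ N \<mu>"
      unfolding P_def by (rule one_diff_power_eq[symmetric])
    finally show "puiseux_coeff ((1 - z) * g) \<mu> = puiseux_coeff 1 \<mu>"
      using pow N by (simp add: puiseux_coeff_diff)
  qed
  then show ?thesis by blast
qed

lemma puiseux_unit:
  assumes "x \<noteq> (0::puiseux)"
  shows "\<exists>y. x * y = 1"
proof -
  obtain a where a: "puiseux_coeff x a \<noteq> 0" "\<forall>\<mu><a. puiseux_coeff x \<mu> = 0"
    using puiseux_least_exponent[OF assms] by blast
  define m where "m = puiseux_monom (1 / puiseux_coeff x a) (- a)"
  define z where "z = 1 - m * x"
  have zc: "puiseux_coeff z \<mu> = (if \<mu> = 0 then 1 else 0) - puiseux_coeff x (\<mu> + a) / puiseux_coeff x a" for \<mu>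
    by (simp add: z_def m_def puiseux_coeff_diff
        one_puiseux.rep_eq puiseux_coeff_monom_times)
  have z0: "puiseux_coeff z \<mu> = 0" if "\<mu> \<le> 0" for \<mu>
    using that a by (cases "\<mu> = 0") (auto simp: zc)
  have "\<exists>d>0. \<forall>\<mu><d. puiseux_coeff z \<mu> = 0"
  proof (cases "z = 0")
    case True
    then show ?thesis by (intro exI[of _ 1]) (simp add: zero_puiseux.rep_eq)
  next
    case False
    then obtain d where d: "puiseux_coeff z d \<noteq> 0" "\<forall>\<mu><d. puiseux_coeff z \<mu> = 0"
      using puiseux_least_exponent by blast
    then have "d > 0" using z0[of d] by (cases "d \<le> 0") auto
    then show ?thesis using d by blast
  qed
  then obtain g where "(1 - z) * g = 1" using puiseux_geometric by blast
  then have "x * (m * g) = 1" by (simp add: z_def mult_ac)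
  then show ?thesis by blast
qed

instantiation puiseux :: field
begin

definition inverse_puiseux :: "puiseux \<Rightarrow> puiseux" where
  "inverse_puiseux x = (if x = 0 then 0 else (THE y. x * y = 1))"

definition divide_puiseux :: "puiseux \<Rightarrow> puiseux \<Rightarrow> puiseux" where
  "divide_puiseux x y = x * inverse y"

instance
proof
  fix x y :: puiseux
  show "inverse x * x = 1" if x: "x \<noteq> 0"
  proof -
    obtain y where y: "x * y = 1" using puiseux_unit[OF x] by blast
    have "z = y" if "x * z = 1" for z
      using that y by (metis mult.assoc mult.commute mult_1)
    then have "(THE y. x * y = 1) = y" using y by blast
    then show ?thesis using y x by (simp add: inverse_puiseux_def mult.commute)
  qed
  show "x div y = x * inverse y" by (rule divide_puiseux_def)
  show "inverse (0::puiseux) = 0" by (simp add: inverse_puiseux_def)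
qed

end

text \<open>For \<open>x \<noteq> 0\<close> the least exponent exists by \<open>puiseux_least_exponent\<close>.\<close>

definition puiseux_lead_coeff :: "puiseux \<Rightarrow> complex" where
  "puiseux_lead_coeff x = puiseux_coeff x (LEAST \<mu>. puiseux_coeff x \<mu> \<noteq> 0)"

definition puiseux_pos :: "puiseux set" where
  "puiseux_pos = {x. x \<noteq> 0 \<and> puiseux_lead_coeff x \<in> \<real> \<and> Re (puiseux_lead_coeff x) > 0}"

section \<open>Laurent polynomials\<close>

text \<open>A Laurent polynomial in \<open>r = CARD('r)\<close> variables is a finitely supported family of
  coefficients indexed by the exponent vectors \<open>v \<in> \<int>\<^sup>r\<close>; the term
  \<open>c x\<^sup>v\<close> is \<^const>\<open>Poly_Mapping.single\<close> \<open>v c\<close>.\<close>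

type_synonym ('r, 'a) laurent_poly = "(int ^ 'r) \<Rightarrow>\<^sub>0 'a"

definition laurent_eval :: "('r::finite, 'a::field) laurent_poly \<Rightarrow> 'a ^ 'r \<Rightarrow> 'a" where
  "laurent_eval W x =
     (\<Sum>v\<in>Poly_Mapping.keys W. Poly_Mapping.lookup W v * (\<Prod>j\<in>UNIV. (x $ j) powi (v $ j)))"

definition laurent_pderiv ::
    "'r::finite \<Rightarrow> ('r, 'a::field) laurent_poly \<Rightarrow> ('r, 'a) laurent_poly" where
  "laurent_pderiv j W =
     (\<Sum>v\<in>Poly_Mapping.keys W.
        Poly_Mapping.single (v - axis j 1) (of_int (v $ j) * Poly_Mapping.lookup W v))"

definition critical_point :: "('r::finite, 'a::field) laurent_poly \<Rightarrow> 'a ^ 'r \<Rightarrow> bool" where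
  "critical_point W x \<longleftrightarrow> (\<forall>j. laurent_eval (laurent_pderiv j W) x = 0)"

definition newton_polytope :: "('r::finite, 'a::zero) laurent_poly \<Rightarrow> (real ^ 'r) set" where
  "newton_polytope W = convex hull ((\<lambda>v. \<chi> j. real_of_int (v $ j)) ` Poly_Mapping.keys W)"

end

theory Submission
  imports Defs
begin

text \<open>Write \<open>v\<^sub>i\<close> for the exponents and \<open>T\<^sub>i = \<gamma>\<^sub>i x\<^sup>v\<^sup>i\<close> for the terms of \<open>W\<close>; the critical points are the solutions of
  \<open>\<Sum> T\<^sub>i v\<^sub>i = 0\<close>, and completeness says that every \<open>w \<noteq> 0\<close> has \<open>\<langle>v\<^sub>i, w\<rangle> > 0\<close> for some \<open>i\<close>.

  Uniqueness: if \<open>y\<close> is the quotient of two critical points, then \<open>\<Sum> T\<^sub>i (y\<^sup>v\<^sup>i - 1) v\<^sub>i = 0\<close>. Pair this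
  equation with minus the vector of orders of \<open>y\<close>, then with the logarithms of its leading coefficients,
  then with the conjugate of the leading coefficient of \<open>y - 1\<close>. Each time all summands are zero or
  positive, so all of them vanish, and \<open>y = 1\<close>.

  Existence: an initial term \<open>x\<^sub>j = e\<^sup>l\<^sup>j t\<^sup>d\<^sup>j\<close> is found order by order. Maximising
  \<open>min\<^sub>i (ord \<gamma>\<^sub>i + \<langle>v\<^sub>i, d\<rangle>)\<close> and minimising the sum of the exponentials of lowest order balances the
  dominant terms; one then continues in the subspace annihilated by their exponents. In a basis adapted
  to the resulting flag, with each equation divided by its own power of \<open>t\<close>, the Jacobian at the
  residue field is invertible, and Hensel's lemma lifts the initial term to a solution.\<close>

section \<open>Initial terms of the critical point\<close>

text \<open>The sum of the positive parts of the \<open>v i \<bullet> w\<close> is continuous and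
  positive on the compact unit sphere of \<open>V\<close>. Some summand is at least the average,
  hence the division by \<open>card N\<close>.\<close>

lemma positively_spanning_coercive:
  fixes v :: "'i \<Rightarrow> 'a::euclidean_space"
  assumes N: "finite N" and V: "subspace V"
    and pos: "\<And>w. w \<in> V \<Longrightarrow> w \<noteq> 0 \<Longrightarrow> \<exists>i\<in>N. v i \<bullet> w > 0"
  obtains c where "c > 0" "\<And>w. w \<in> V \<Longrightarrow> w \<noteq> 0 \<Longrightarrow> \<exists>i\<in>N. v i \<bullet> w \<ge> c * norm w"
proof (cases "V \<subseteq> {0}")
  case True
  then show ?thesis using that[of 1] by auto
next
  case False
  then obtain w0 where w0: "w0 \<in> V" "w0 \<noteq> 0" by auto
  have N0: "N \<noteq> {}" using pos[OF w0] by auto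
  define f where "f w = (\<Sum>i\<in>N. max 0 (v i \<bullet> w))" for w
  define S where "S = sphere 0 1 \<inter> V"
  have S: "compact S" unfolding S_def using V closed_subspace by (intro compact_Int_closed) auto
  have "w0 /\<^sub>R norm w0 \<in> S" using w0 V by (auto simp: S_def subspace_scale)
  then have "S \<noteq> {}" by blast
  moreover have "continuous_on S f" unfolding f_def by (intro continuous_intros)
  ultimately obtain x where x: "x \<in> S" "\<And>y. y \<in> S \<Longrightarrow> f x \<le> f y"
    using continuous_attains_inf[OF S] by blast
  have "x \<noteq> 0" "x \<in> V" using x by (auto simp: S_def)
  then obtain i where i: "i \<in> N" "v i \<bullet> x > 0" using pos by blast
  have "0 < max 0 (v i \<bullet> x)" using i by auto
  also have "\<dots> \<le> f x" unfolding f_def using i N by (intro member_le_sum) auto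
  finally have fx: "f x > 0" .
  define c where "c = f x / card N"
  have cN: "card N > 0" using N N0 by (simp add: card_gt_0_iff)
  show ?thesis
  proof
    show "c > 0" using fx cN by (simp add: c_def)
  next
    fix w assume w: "w \<in> V" "w \<noteq> 0"
    define y where "y = w /\<^sub>R norm w"
    have y: "y \<in> S" using w V by (auto simp: S_def y_def subspace_scale)
    have "\<exists>i\<in>N. v i \<bullet> y \<ge> c"
    proof (rule ccontr)
      assume "\<not> (\<exists>i\<in>N. v i \<bullet> y \<ge> c)"
      then have "f y < (\<Sum>i\<in>N. c)" unfolding f_def
        using \<open>N \<noteq> {}\<close> N fx cN by (intro sum_strict_mono) (auto simp: c_def)
      then show False using x(2)[OF y] cN by (simp add: c_def)
    qed
    then show "\<exists>i\<in>N. v i \<bullet> w \<ge> c * norm w"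
      using w by (auto simp: y_def field_simps)
  qed
qed

text \<open>The points of \<open>V\<close> with value at most \<open>f 0\<close> lie in a ball, so a
  minimum over the compact set \<open>cball 0 K \<inter> V\<close> is one over all of
  \<open>V\<close>.\<close>

lemma coercive_attains_min:
  fixes f :: "'a::euclidean_space \<Rightarrow> real"
  assumes V: "subspace V" and f: "continuous_on UNIV f"
    and bd: "\<And>x. x \<in> V \<Longrightarrow> f x \<le> f 0 \<Longrightarrow> norm x \<le> K"
  obtains x where "x \<in> V" "\<And>y. y \<in> V \<Longrightarrow> f x \<le> f y"
proof -
  have 0: "0 \<in> V" using V by (rule subspace_0)
  have K: "0 \<le> K" using bd[OF 0] by simp
  have "compact (cball 0 K \<inter> V)" using closed_subspace[OF V] by (intro compact_Int_closed) auto
  moreover have "0 \<in> cball 0 K \<inter> V" using 0 K by simp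
  then have "cball 0 K \<inter> V \<noteq> {}" by blast
  ultimately obtain x where x: "x \<in> cball 0 K \<inter> V" "\<And>y. y \<in> cball 0 K \<inter> V \<Longrightarrow> f x \<le> f y"
    using continuous_attains_inf[of "cball 0 K \<inter> V" f] continuous_on_subset[OF f] by blast
  have "f x \<le> f y" if "y \<in> V" for y
  proof (cases "f y \<le> f 0")
    case True
    then show ?thesis using x(2) bd that by auto
  next
    case False
    then show ?thesis using x(2)[of 0] 0 K by auto
  qed
  then show ?thesis using x that by blast
qed

lemma continuous_on_Min_image:
  fixes f :: "'i \<Rightarrow> 'a::topological_space \<Rightarrow> real"
  assumes "finite R" "R \<noteq> {}" "\<And>i. i \<in> R \<Longrightarrow> continuous_on S (f i)"
  shows "continuous_on S (\<lambda>x. Min ((\<lambda>i. f i x) ` R))"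
  using assms
proof (induction rule: finite_ne_induct)
  case (insert i R)
  then have "continuous_on S (\<lambda>x. min (f i x) (Min ((\<lambda>i. f i x) ` R)))"
    by (intro continuous_intros) auto
  then show ?case using insert by simp
qed auto

text \<open>A maximiser of the tropical polynomial whose set of tight terms is smallest lies in the
  relative interior of the set of maximisers, so the tight terms balance each other.\<close>

lemma tropical_max_balanced:
  fixes v :: "'i \<Rightarrow> 'a::euclidean_space" and \<mu> :: "'i \<Rightarrow> real"
  assumes R: "finite R" "R \<noteq> {}" and U: "subspace U"
    and pos: "\<And>w. w \<in> U \<Longrightarrow> w \<noteq> 0 \<Longrightarrow> \<exists>i\<in>R. v i \<bullet> w > 0"
  obtains d \<tau> where "d \<in> U" "\<forall>i\<in>R. \<tau> \<le> \<mu> i + v i \<bullet> d" "\<exists>i\<in>R. \<mu> i + v i \<bullet> d = \<tau>"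
    "\<forall>w\<in>U. (\<forall>i\<in>R. \<mu> i + v i \<bullet> d = \<tau> \<longrightarrow> v i \<bullet> w \<ge> 0) \<longrightarrow>
      (\<forall>i\<in>R. \<mu> i + v i \<bullet> d = \<tau> \<longrightarrow> v i \<bullet> w = 0)"
    "\<forall>m. (\<forall>i\<in>R. m < \<mu> i) \<longrightarrow> m < \<tau>"
proof -
  obtain c where c: "c > 0" "\<And>w. w \<in> U \<Longrightarrow> w \<noteq> 0 \<Longrightarrow> \<exists>i\<in>R. v i \<bullet> w \<ge> c * norm w"
    using positively_spanning_coercive[OF R(1) U pos] by blast
  define f where "f d = Min ((\<lambda>i. \<mu> i + v i \<bullet> d) ` R)" for d
  have f_le: "f d \<le> \<mu> i + v i \<bullet> d" if "i \<in> R" for i d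
    unfolding f_def using R that by (intro Min_le) auto
  have f_at: "\<exists>i\<in>R. f d = \<mu> i + v i \<bullet> d" for d
  proof -
    have "f d \<in> (\<lambda>i. \<mu> i + v i \<bullet> d) ` R" unfolding f_def using R by (intro Min_in) auto
    then show ?thesis by auto
  qed
  define M where "M = Max (\<mu> ` R)"
  have M: "\<mu> i \<le> M" if "i \<in> R" for i unfolding M_def using R that by (intro Max_ge) auto
  \<comment> \<open>Coercivity applied to \<open>- d\<close> yields a term that falls by at least
    \<open>c * norm d\<close>, so points at least as good as 0 are bounded.\<close>
  have bound: "norm d \<le> (M - f 0) / c" if d: "d \<in> U" and le: "- f d \<le> - f 0" for d
  proof (cases "d = 0")
    case True
    obtain i where "i \<in> R" "f 0 = \<mu> i + v i \<bullet> 0" using f_at by blast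
    then have "0 \<le> M - f 0" using M by auto
    then show ?thesis using True c by simp
  next
    case False
    obtain i where i: "i \<in> R" "v i \<bullet> (- d) \<ge> c * norm (- d)"
      using c(2)[of "- d"] d U False by (auto simp: subspace_neg)
    have "f 0 \<le> \<mu> i + v i \<bullet> d" using f_le[OF i(1), of d] le by simp
    then have "c * norm d \<le> M - f 0" using M[OF i(1)] i(2) by simp
    then show ?thesis using c by (simp add: field_simps)
  qed
  have "continuous_on UNIV (\<lambda>d. - f d)"
    unfolding f_def using R by (intro continuous_intros continuous_on_Min_image)
  then obtain d1 where d1: "d1 \<in> U" "\<And>y. y \<in> U \<Longrightarrow> - f d1 \<le> - f y"
    using coercive_attains_min[OF U, of "\<lambda>d. - f d"] bound by metis
  define \<tau> where "\<tau> = f d1"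
  have top: "\<exists>i\<in>R. \<mu> i + v i \<bullet> d \<le> \<tau>" if "d \<in> U" for d
    using f_at[of d] d1(2)[OF that] by (auto simp: \<tau>_def)
  define T where "T d = {i\<in>R. \<mu> i + v i \<bullet> d = \<tau>}" for d
  define P where "P d \<longleftrightarrow> d \<in> U \<and> (\<forall>i\<in>R. \<tau> \<le> \<mu> i + v i \<bullet> d)" for d
  have "P d1" using d1 f_le by (auto simp: P_def \<tau>_def)
  then obtain d where d: "P d" "\<And>y. P y \<Longrightarrow> card (T d) \<le> card (T y)"
    using ex_has_least_nat[of P d1 "\<lambda>d. card (T d)"] by blast
  have dU: "d \<in> U" and dge: "\<And>i. i \<in> R \<Longrightarrow> \<tau> \<le> \<mu> i + v i \<bullet> d" using d(1) by (auto simp: P_def)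
  show ?thesis
  proof (rule that[OF dU])
    show "\<forall>i\<in>R. \<tau> \<le> \<mu> i + v i \<bullet> d" using dge by blast
    show "\<exists>i\<in>R. \<mu> i + v i \<bullet> d = \<tau>" using top[OF dU] dge by force
  next
    show "\<forall>w\<in>U. (\<forall>i\<in>R. \<mu> i + v i \<bullet> d = \<tau> \<longrightarrow> v i \<bullet> w \<ge> 0) \<longrightarrow>
      (\<forall>i\<in>R. \<mu> i + v i \<bullet> d = \<tau> \<longrightarrow> v i \<bullet> w = 0)"
    proof (intro ballI impI, rule ccontr)
      fix w i
      assume w: "w \<in> U" and ge0: "\<forall>i\<in>R. \<mu> i + v i \<bullet> d = \<tau> \<longrightarrow> v i \<bullet> w \<ge> 0"
        and i: "i \<in> R" "\<mu> i + v i \<bullet> d = \<tau>"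
      note ge = ge0[rule_format]
      \<comment> \<open>Move from \<open>d\<close> a little along \<open>w\<close>: slack terms stay
        above \<tau> by continuity, tight ones do not decrease, and term \<open>i\<close> stops
        being tight. This is a maximiser with fewer tight terms.\<close>
      assume "v i \<bullet> w \<noteq> 0"
      then have vi: "v i \<bullet> w > 0" using ge[OF i] by simp
      have "\<forall>\<^sub>F s in at_right 0. \<forall>k\<in>R. \<mu> k + v k \<bullet> d \<noteq> \<tau> \<longrightarrow> \<tau> < \<mu> k + v k \<bullet> (d + s *\<^sub>R w)"
      proof (intro eventually_ball_finite R(1) ballI)
        fix k assume k: "k \<in> R"
        have lim: "((\<lambda>s. \<mu> k + v k \<bullet> (d + s *\<^sub>R w)) \<longlongrightarrow> \<mu> k + v k \<bullet> (d + 0 *\<^sub>R w)) (at_right 0)"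
          by (intro tendsto_intros)
        show "\<forall>\<^sub>F s in at_right 0. \<mu> k + v k \<bullet> d \<noteq> \<tau> \<longrightarrow> \<tau> < \<mu> k + v k \<bullet> (d + s *\<^sub>R w)"
        proof (cases "\<mu> k + v k \<bullet> d = \<tau>")
          case False
          then have "\<tau> < \<mu> k + v k \<bullet> (d + 0 *\<^sub>R w)" using dge[OF k] by simp
          from order_tendstoD(1)[OF lim this] show ?thesis by (rule eventually_mono) simp
        qed simp
      qed
      then have "\<forall>\<^sub>F s in at_right 0. s > 0 \<and>
          (\<forall>k\<in>R. \<mu> k + v k \<bullet> d \<noteq> \<tau> \<longrightarrow> \<tau> < \<mu> k + v k \<bullet> (d + s *\<^sub>R w))"
        by (intro eventually_conj) (auto simp: eventually_at_right_less)
      then obtain s :: real where s: "s > 0"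
        "\<And>k. k \<in> R \<Longrightarrow> \<mu> k + v k \<bullet> d \<noteq> \<tau> \<Longrightarrow> \<tau> < \<mu> k + v k \<bullet> (d + s *\<^sub>R w)"
        using eventually_happens[of _ "at_right (0::real)"] trivial_limit_at_right_real by blast
      let ?e = "d + s *\<^sub>R w"
      have e: "\<tau> \<le> \<mu> k + v k \<bullet> ?e" if "k \<in> R" for k
        using s(2)[OF that] ge[OF that] s(1)
        by (cases "\<mu> k + v k \<bullet> d = \<tau>") (auto simp: inner_simps)
      have "P ?e" using e dU w U by (auto simp: P_def subspace_add subspace_scale)
      moreover have "T ?e \<subset> T d"
      proof
        show "T ?e \<subseteq> T d" using s(2) by (force simp: T_def)
        have "i \<in> T d" "i \<notin> T ?e" using i vi s(1) by (auto simp: T_def inner_simps)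
        then show "T ?e \<noteq> T d" by blast
      qed
      then have "card (T ?e) < card (T d)" using R by (intro psubset_card_mono) (auto simp: T_def)
      ultimately show False using d(2)[of ?e] by simp
    qed
  next
    show "\<forall>m. (\<forall>i\<in>R. m < \<mu> i) \<longrightarrow> m < \<tau>"
    proof (intro allI impI)
      fix m assume m: "\<forall>i\<in>R. m < \<mu> i"
      \<comment> \<open>The maximum is at least the value at 0, which is the least of the
        \<open>\<mu> i\<close>.\<close>
      obtain i where "i \<in> R" "f 0 = \<mu> i + v i \<bullet> 0" using f_at by blast
      then have "m < f 0" using m by simp
      then show "m < \<tau>" using d1(2)[of 0] subspace_0[OF U] by (simp add: \<tau>_def)
    qed
  qed
qed

text \<open>The point is a minimiser of the sum of exponentials \<open>G\<close>. Since
  \<open>G\<close> is constant along \<open>U'\<close>, the common kernel of the exponents in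
  \<open>U\<close>, it is minimised on the orthogonal complement \<open>V\<close> of
  \<open>U'\<close> in \<open>U\<close>, where balance makes the exponents positively spanning and
  \<open>G\<close> coercive.\<close>

lemma exp_sum_critical_point:
  fixes v :: "'i \<Rightarrow> 'a::euclidean_space" and \<alpha> :: "'i \<Rightarrow> real"
  assumes I: "finite I" and \<alpha>: "\<And>i. i \<in> I \<Longrightarrow> \<alpha> i > 0" and U: "subspace U"
    and bal: "\<And>w i. \<lbrakk>w \<in> U; \<And>i. i \<in> I \<Longrightarrow> v i \<bullet> w \<ge> 0; i \<in> I\<rbrakk> \<Longrightarrow> v i \<bullet> w = 0"
  shows "\<exists>l\<in>U. \<forall>w\<in>U. (\<Sum>i\<in>I. \<alpha> i * exp (v i \<bullet> l) * (v i \<bullet> w)) = 0"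
proof -
  define U' where "U' = {w\<in>U. \<forall>i\<in>I. v i \<bullet> w = 0}"
  have U': "subspace U'"
    unfolding U'_def using U by (auto simp: subspace_def inner_simps)
  define V where "V = {w\<in>U. \<forall>u\<in>U'. u \<bullet> w = 0}"
  have V: "subspace V"
    unfolding V_def using U by (auto simp: subspace_def inner_simps)
  have pos: "\<exists>i\<in>I. v i \<bullet> w > 0" if w: "w \<in> V" "w \<noteq> 0" for w
  proof (rule ccontr)
    assume *: "\<not> (\<exists>i\<in>I. v i \<bullet> w > 0)"
    have wU: "- w \<in> U" using w U by (auto simp: V_def subspace_neg)
    have "v i \<bullet> (- w) = 0" if "i \<in> I" for i
      by (rule bal[OF wU _ that]) (use * in \<open>auto simp: not_less\<close>)
    then have "w \<in> U'" using w by (auto simp: U'_def V_def)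
    then show False using w by (auto simp: V_def)
  qed
  obtain c where c: "c > 0" "\<And>w. w \<in> V \<Longrightarrow> w \<noteq> 0 \<Longrightarrow> \<exists>i\<in>I. v i \<bullet> w \<ge> c * norm w"
    using positively_spanning_coercive[OF I V pos] by blast
  define G where "G l = (\<Sum>i\<in>I. \<alpha> i * exp (v i \<bullet> l))" for l
  \<comment> \<open>The extra 1 keeps the minimum defined for empty \<open>I\<close>.\<close>
  define a where "a = Min (insert 1 (\<alpha> ` I))"
  have a: "a > 0" "\<And>i. i \<in> I \<Longrightarrow> a \<le> \<alpha> i" unfolding a_def using I \<alpha> by auto
  have G0: "G l \<ge> 0" for l unfolding G_def using \<alpha> by (intro sum_nonneg) (auto intro: less_imp_le)
  have bound: "norm x \<le> G 0 / (a * c)" if x: "x \<in> V" "G x \<le> G 0" for x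
  proof (cases "x = 0")
    case True
    then show ?thesis using a c G0[of 0] by simp
  next
    case False
    then obtain i where i: "i \<in> I" "v i \<bullet> x \<ge> c * norm x" using c(2) x by blast
    have "c * norm x \<le> exp (v i \<bullet> x)" using i(2) exp_ge_add_one_self[of "v i \<bullet> x"] by linarith
    then have "a * (c * norm x) \<le> \<alpha> i * exp (v i \<bullet> x)"
      using a(1) a(2)[OF i(1)] c(1) by (intro mult_mono) auto
    also have "\<dots> \<le> G x" unfolding G_def using i(1) I \<alpha>
      by (intro member_le_sum[where f = "\<lambda>i. \<alpha> i * exp (v i \<bullet> x)"]) (auto intro: less_imp_le)
    finally show ?thesis using x(2) a(1) c(1) by (simp add: field_simps)
  qed
  have "continuous_on UNIV G" unfolding G_def by (intro continuous_intros)
  then obtain l where l: "l \<in> V" "\<And>y. y \<in> V \<Longrightarrow> G l \<le> G y"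
    using coercive_attains_min[OF V] bound by metis
  have crit: "(\<Sum>i\<in>I. \<alpha> i * exp (v i \<bullet> l) * (v i \<bullet> w)) = 0" if w: "w \<in> V" for w
  proof -
    have "((\<lambda>s. G (l + s *\<^sub>R w)) has_real_derivative
        (\<Sum>i\<in>I. \<alpha> i * exp (v i \<bullet> l) * (v i \<bullet> w))) (at 0)"
      unfolding G_def inner_simps by (auto intro!: derivative_eq_intros sum.cong)
    moreover have "G (l + 0 *\<^sub>R w) \<le> G (l + s *\<^sub>R w)" for s
      using l w V by (auto intro!: l(2) subspace_add subspace_scale)
    ultimately show ?thesis using DERIV_local_min[where d=1] by fastforce
  qed
  show ?thesis
  proof (intro bexI ballI)
    show "l \<in> U" using l by (auto simp: V_def)
    fix w assume w: "w \<in> U"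
    \<comment> \<open>The component in \<open>U'\<close> pairs to 0 with every \<open>v i\<close>,
      so testing against \<open>V\<close> suffices.\<close>
    obtain w1 w2 where w12: "w1 \<in> span U'" "\<And>u. u \<in> span U' \<Longrightarrow> orthogonal w2 u" "w = w1 + w2"
      using orthogonal_subspace_decomp_exists by blast
    have w1: "w1 \<in> U'" using w12(1) U' by (simp add: span_eq_iff[THEN iffD2])
    then have "w2 \<in> U" using w w12(3) U subspace_diff[OF U, of w w1] by (auto simp: U'_def)
    moreover have "u \<bullet> w2 = 0" if "u \<in> U'" for u
      using w12(2)[of u] that by (simp add: span_base orthogonal_def inner_commute)
    ultimately have "w2 \<in> V" by (simp add: V_def)
    from crit[OF this] show "(\<Sum>i\<in>I. \<alpha> i * exp (v i \<bullet> l) * (v i \<bullet> w)) = 0"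
      using w1 by (simp add: w12(3) inner_simps U'_def)
  qed
qed

section \<open>The flag of balanced directions\<close>

text \<open>Here \<open>\<mu> i\<close> and \<open>\<alpha> i\<close> are the order and the leading coefficient of the \<open>i\<close>th coefficient of \<open>W\<close>, and
  \<open>d\<close>, \<open>l\<close> those of the point sought (\<open>l\<close> after taking logarithms). The equation in direction \<open>b\<close> has
  order \<open>\<kappa> b\<close>; its leading coefficient vanishes, and the linearised system is nondegenerate.\<close>

definition tropical_flag ::
    "'i set \<Rightarrow> ('i \<Rightarrow> 'a::euclidean_space) \<Rightarrow> ('i \<Rightarrow> real) \<Rightarrow> ('i \<Rightarrow> real) \<Rightarrow> 'a set \<Rightarrow>
      'a \<Rightarrow> 'a \<Rightarrow> 'a set \<Rightarrow> ('a \<Rightarrow> real) \<Rightarrow> bool" where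
  "tropical_flag N v \<mu> \<alpha> U d l B \<kappa> \<longleftrightarrow>
    d \<in> U \<and> l \<in> U \<and> independent B \<and> span B = U \<and>
    (\<forall>b\<in>B. \<forall>i\<in>N. \<mu> i + v i \<bullet> d < \<kappa> b \<longrightarrow> v i \<bullet> b = 0) \<and>
    (\<forall>b\<in>B. (\<Sum>i | i \<in> N \<and> \<mu> i + v i \<bullet> d = \<kappa> b. \<alpha> i * exp (v i \<bullet> l) * (v i \<bullet> b)) = 0) \<and>
    (\<forall>u\<in>U. (\<forall>b\<in>B. (\<Sum>i | i \<in> N \<and> \<mu> i + v i \<bullet> d = \<kappa> b.
        \<alpha> i * exp (v i \<bullet> l) * (v i \<bullet> b) * (v i \<bullet> u)) = 0) \<longrightarrow> u = 0)"

text \<open>Induction on the dimension of \<open>U\<close>, the space of directions not yet fixed: balance the terms of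
  lowest order and continue in the subspace annihilated by their exponents.\<close>

lemma tropical_flag_exists:
  fixes v :: "'i \<Rightarrow> 'a::euclidean_space" and \<mu> \<alpha> :: "'i \<Rightarrow> real"
  assumes N: "finite N" and "\<And>i. i \<in> N \<Longrightarrow> \<alpha> i > 0" and "subspace U"
    and "\<And>w. w \<in> U \<Longrightarrow> w \<noteq> 0 \<Longrightarrow> \<exists>i\<in>N. v i \<bullet> w > 0"
  shows "\<exists>d l B \<kappa>. tropical_flag N v \<mu> \<alpha> U d l B \<kappa> \<and>
    (\<forall>m. (\<forall>i\<in>N. (\<exists>w\<in>U. v i \<bullet> w \<noteq> 0) \<longrightarrow> m < \<mu> i) \<longrightarrow>
         (\<forall>i\<in>N. (\<exists>w\<in>U. v i \<bullet> w \<noteq> 0) \<longrightarrow> m < \<mu> i + v i \<bullet> d))"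
  using assms(2-)
proof (induction "dim U" arbitrary: U \<mu> \<alpha> rule: less_induct)
  case less
  note \<alpha> = less.prems(1) and U = less.prems(2) and pos = less.prems(3)
  show ?case
  proof (cases "U \<subseteq> {0}")
    case True
    then have "U = {0}" using subspace_0[OF U] by auto
    then have "tropical_flag N v \<mu> \<alpha> U 0 0 {} (\<lambda>_. 0)"
      by (simp add: tropical_flag_def independent_empty)
    moreover have "v i \<bullet> w = 0" if "w \<in> U" for i w using that \<open>U = {0}\<close> by simp
    ultimately show ?thesis by blast
  next
    case False
    \<comment> \<open>\<open>R\<close> indexes the terms that still vary along \<open>U\<close>; the
      others drop out of every equation in a direction of \<open>U\<close>.\<close>
    define R where "R = {i\<in>N. \<exists>w\<in>U. v i \<bullet> w \<noteq> 0}"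
    have R: "finite R" using N by (simp add: R_def)
    have perp: "v i \<bullet> w = 0" if "i \<in> N" "i \<notin> R" "w \<in> U" for i w
      using that by (auto simp: R_def)
    have posR: "\<exists>i\<in>R. v i \<bullet> w > 0" if w: "w \<in> U" "w \<noteq> 0" for w
    proof -
      obtain i where "i \<in> N" "v i \<bullet> w > 0" using pos[OF w] by blast
      moreover from this have "v i \<bullet> w \<noteq> 0" by simp
      ultimately show ?thesis unfolding R_def using w(1) by blast
    qed
    obtain w0 where "w0 \<in> U" "w0 \<noteq> 0" using False by blast
    from posR[OF this] have "R \<noteq> {}" by blast
    obtain d0 \<tau> where d0: "d0 \<in> U" "\<forall>i\<in>R. \<tau> \<le> \<mu> i + v i \<bullet> d0"
        "\<exists>i\<in>R. \<mu> i + v i \<bullet> d0 = \<tau>"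
      and bal: "\<forall>w\<in>U. (\<forall>i\<in>R. \<mu> i + v i \<bullet> d0 = \<tau> \<longrightarrow> v i \<bullet> w \<ge> 0) \<longrightarrow>
        (\<forall>i\<in>R. \<mu> i + v i \<bullet> d0 = \<tau> \<longrightarrow> v i \<bullet> w = 0)"
      and low: "\<forall>m. (\<forall>i\<in>R. m < \<mu> i) \<longrightarrow> m < \<tau>"
      by (rule tropical_max_balanced[OF R \<open>R \<noteq> {}\<close> U, of v \<mu>]) (erule (1) posR, rule that)
    define I where "I = {i\<in>R. \<mu> i + v i \<bullet> d0 = \<tau>}"
    have "finite I" unfolding I_def using R by simp
    moreover have "I \<noteq> {}" "I \<subseteq> R" using d0(3) by (auto simp: I_def)
    moreover from this have "I \<subseteq> N" by (auto simp: R_def)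
    ultimately have I: "finite I" "I \<noteq> {}" "I \<subseteq> R" "I \<subseteq> N" by blast+
    have \<alpha>I: "\<alpha> i > 0" if "i \<in> I" for i using \<alpha> that I by auto
    have balI: "v i \<bullet> w = 0" if "w \<in> U" "\<And>i. i \<in> I \<Longrightarrow> v i \<bullet> w \<ge> 0" "i \<in> I" for w i
      using bal that(1,3) that(2)[unfolded I_def] unfolding I_def by blast
    have "\<exists>l\<in>U. \<forall>w\<in>U. (\<Sum>i\<in>I. \<alpha> i * exp (v i \<bullet> l) * (v i \<bullet> w)) = 0"
      by (rule exp_sum_critical_point[OF I(1) _ U]) (fact \<alpha>I, rule balI)
    then obtain l0 where l0: "l0 \<in> U"
      "\<And>w. w \<in> U \<Longrightarrow> (\<Sum>i\<in>I. \<alpha> i * exp (v i \<bullet> l0) * (v i \<bullet> w)) = 0"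
      by blast
    define U' where "U' = {w\<in>U. \<forall>i\<in>I. v i \<bullet> w = 0}"
    have U': "subspace U'" unfolding U'_def using U by (auto simp: subspace_def inner_simps)
    have "U' \<subseteq> U" by (auto simp: U'_def)
    have "U' \<noteq> U" using I(2,3) by (force simp: U'_def R_def)
    then have dim: "dim U' < dim U"
      using \<open>U' \<subseteq> U\<close> U U' by (metis dim_psubset psubsetI span_eq_iff)
    have pos': "\<exists>i\<in>N. v i \<bullet> w > 0" if "w \<in> U'" "w \<noteq> 0" for w
      using pos[of w] that by (auto simp: U'_def)
    \<comment> \<open>Orders and leading coefficients of the terms once the first approximation
      \<open>d0\<close>, \<open>l0\<close> is substituted.\<close>
    define \<mu>' where "\<mu>' i = \<mu> i + v i \<bullet> d0" for i
    define \<alpha>' where "\<alpha>' i = \<alpha> i * exp (v i \<bullet> l0)" for i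
    have "\<exists>d l B \<kappa>. tropical_flag N v \<mu>' \<alpha>' U' d l B \<kappa> \<and>
      (\<forall>m. (\<forall>i\<in>N. (\<exists>w\<in>U'. v i \<bullet> w \<noteq> 0) \<longrightarrow> m < \<mu>' i) \<longrightarrow>
           (\<forall>i\<in>N. (\<exists>w\<in>U'. v i \<bullet> w \<noteq> 0) \<longrightarrow> m < \<mu>' i + v i \<bullet> d))"
    proof (rule less.hyps[OF dim _ U'])
      show "\<alpha>' i > 0" if "i \<in> N" for i using \<alpha>[OF that] by (simp add: \<alpha>'_def)
    qed (rule pos')
    then obtain d1 l1 B' \<kappa>' where flag: "tropical_flag N v \<mu>' \<alpha>' U' d1 l1 B' \<kappa>'"
      and low': "\<forall>m. (\<forall>i\<in>N. (\<exists>w\<in>U'. v i \<bullet> w \<noteq> 0) \<longrightarrow> m < \<mu>' i) \<longrightarrow>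
         (\<forall>i\<in>N. (\<exists>w\<in>U'. v i \<bullet> w \<noteq> 0) \<longrightarrow> m < \<mu>' i + v i \<bullet> d1)"
      by (elim exE conjE) (rule that)
    have d1: "d1 \<in> U'" and l1: "l1 \<in> U'" and B': "independent B'" "span B' = U'"
      using flag by (simp_all add: tropical_flag_def)
    have kap': "v i \<bullet> b = 0" if "b \<in> B'" "i \<in> N" "\<mu>' i + v i \<bullet> d1 < \<kappa>' b" for b i
      using flag that unfolding tropical_flag_def by blast
    have sum': "(\<Sum>i | i \<in> N \<and> \<mu>' i + v i \<bullet> d1 = \<kappa>' b. \<alpha>' i * exp (v i \<bullet> l1) * (v i \<bullet> b)) = 0"
      if "b \<in> B'" for b
      using flag that unfolding tropical_flag_def by blast
    have inj': "u = 0" if "u \<in> U'" "\<forall>b\<in>B'. (\<Sum>i | i \<in> N \<and> \<mu>' i + v i \<bullet> d1 = \<kappa>' b.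
         \<alpha>' i * exp (v i \<bullet> l1) * (v i \<bullet> b) * (v i \<bullet> u)) = 0" for u
      using flag that unfolding tropical_flag_def by blast
    define d where "d = d0 + d1"
    define l where "l = l0 + l1"
    have \<nu>: "\<mu>' i + v i \<bullet> d1 = \<mu> i + v i \<bullet> d" for i
      by (simp add: \<mu>'_def d_def inner_simps)
    have a: "\<alpha>' i * exp (v i \<bullet> l1) = \<alpha> i * exp (v i \<bullet> l)" for i
      by (simp add: \<alpha>'_def l_def inner_simps exp_add)
    have "B' \<subseteq> U" using B'(2) \<open>U' \<subseteq> U\<close> span_superset by blast
    then obtain B where B: "B' \<subseteq> B" "B \<subseteq> U" "independent B" "U \<subseteq> span B"
      using maximal_independent_subset_extend[OF _ B'(1)] by metis
    have spanB: "span B = U" using B U by (meson span_minimal subset_antisym)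
    \<comment> \<open>Directions from \<open>B'\<close> keep the level given by the induction; the
      added ones belong to the lowest level \<tau>.\<close>
    define \<kappa> where "\<kappa> b = (if b \<in> B' then \<kappa>' b else \<tau>)" for b
    \<comment> \<open>Here the order bound carried through the induction is used: a term that varies
      along \<open>U'\<close> stays above \<tau> after the move by \<open>d1\<close>, and any other
      term is not changed by \<open>d1\<close>.\<close>
    have far: "\<tau> < \<mu> i + v i \<bullet> d" if i: "i \<in> R" "i \<notin> I" for i
    proof (cases "\<exists>w\<in>U'. v i \<bullet> w \<noteq> 0")
      case True
      have "\<tau> < \<mu>' k" if "k \<in> N" "\<exists>w\<in>U'. v k \<bullet> w \<noteq> 0" for k
      proof -
        have "k \<in> R" "k \<notin> I" using that by (auto simp: R_def U'_def)
        then show ?thesis using d0(2) by (auto simp: I_def \<mu>'_def)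
      qed
      then show ?thesis using low'[rule_format, of \<tau>] i True unfolding \<nu> by (auto simp: R_def)
    next
      case False
      then have "v i \<bullet> d1 = 0" using d1 by auto
      then show ?thesis using i d0(2) by (auto simp: I_def d_def inner_simps)
    qed
    have near: "\<mu> i + v i \<bullet> d = \<tau>" if "i \<in> I" for i
      using that d1 by (auto simp: I_def d_def U'_def inner_simps)
    \<comment> \<open>By \<open>far\<close>, indices of order \<tau> outside \<open>I\<close> lie
      outside \<open>R\<close>, where the summands vanish.\<close>
    have level: "(\<Sum>i | i \<in> N \<and> \<mu> i + v i \<bullet> d = \<tau>. g i) = sum g I"
      if "\<And>i. i \<in> N \<Longrightarrow> i \<notin> R \<Longrightarrow> g i = 0" for g :: "'i \<Rightarrow> real"
    proof (rule sum.mono_neutral_right)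
      show "\<forall>i\<in>{i \<in> N. \<mu> i + v i \<bullet> d = \<tau>} - I. g i = 0"
      proof
        fix i assume "i \<in> {i \<in> N. \<mu> i + v i \<bullet> d = \<tau>} - I"
        then show "g i = 0" using far[of i] that[of i] by (cases "i \<in> R") auto
      qed
    qed (use N near I in auto)
    have l1I: "v i \<bullet> l = v i \<bullet> l0" if "i \<in> I" for i
      using that l1 by (simp add: l_def inner_simps U'_def)
    have "tropical_flag N v \<mu> \<alpha> U d l B \<kappa>"
      unfolding tropical_flag_def
    proof (intro conjI ballI impI)
      show "d \<in> U" "l \<in> U" using d0(1) d1 l0(1) l1 U \<open>U' \<subseteq> U\<close>
        by (auto simp: d_def l_def subspace_add)
      show "independent B" "span B = U" by fact+
    next
      fix b i assume b: "b \<in> B" and i: "i \<in> N" "\<mu> i + v i \<bullet> d < \<kappa> b"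
      show "v i \<bullet> b = 0"
      proof (cases "b \<in> B'")
        case True
        then show ?thesis using kap'[of b i] i unfolding \<nu> by (simp add: \<kappa>_def)
      next
        case False
        then have "\<mu> i + v i \<bullet> d < \<tau>" using i by (simp add: \<kappa>_def)
        then have "i \<notin> R" using far[of i] near[of i] by force
        then show ?thesis using perp i B(2) b by blast
      qed
    next
      fix b assume b: "b \<in> B"
      show "(\<Sum>i | i \<in> N \<and> \<mu> i + v i \<bullet> d = \<kappa> b. \<alpha> i * exp (v i \<bullet> l) * (v i \<bullet> b)) = 0"
      proof (cases "b \<in> B'")
        case True
        then show ?thesis using sum'[of b] unfolding \<nu> a by (simp add: \<kappa>_def)
      next
        case False
        have bU: "b \<in> U" using b B by auto
        have "(\<Sum>i | i \<in> N \<and> \<mu> i + v i \<bullet> d = \<tau>. \<alpha> i * exp (v i \<bullet> l) * (v i \<bullet> b))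
          = (\<Sum>i\<in>I. \<alpha> i * exp (v i \<bullet> l) * (v i \<bullet> b))"
          by (rule level) (use perp bU in auto)
        also have "\<dots> = 0" using l0(2)[OF bU] l1I by simp
        finally show ?thesis using False by (simp add: \<kappa>_def)
      qed
    next
      fix u assume u: "u \<in> U" and zero: "\<forall>b\<in>B. (\<Sum>i | i \<in> N \<and> \<mu> i + v i \<bullet> d = \<kappa> b.
        \<alpha> i * exp (v i \<bullet> l) * (v i \<bullet> b) * (v i \<bullet> u)) = 0"
      \<comment> \<open>\<open>B'\<close> lies in \<open>Z\<close> trivially, the rest of
        \<open>B\<close> by assumption, so \<open>Z\<close> contains \<open>u\<close> itself. The
        sum for \<open>b = u\<close> consists of nonnegative terms with factor
        \<open>(v i \<bullet> u)^2\<close>; hence \<open>u\<close> lies in \<open>U'\<close>, where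
        the induction applies.\<close>
      define Z where "Z = {b. (\<Sum>i\<in>I. \<alpha> i * exp (v i \<bullet> l) * (v i \<bullet> b) * (v i \<bullet> u)) = 0}"
      define q where "q i = \<alpha> i * exp (v i \<bullet> l) * (v i \<bullet> u)" for i
      have "Z = {b. b \<bullet> (\<Sum>i\<in>I. q i *\<^sub>R v i) = 0}"
        by (simp add: Z_def q_def inner_sum_right inner_commute mult_ac)
      then have "subspace Z" by (simp add: subspace_hyperplane2)
      moreover have "B \<subseteq> Z"
      proof
        fix b assume b: "b \<in> B"
        show "b \<in> Z"
        proof (cases "b \<in> B'")
          case True
          then have "b \<in> U'" using B'(2) span_base by blast
          then show ?thesis by (simp add: Z_def U'_def)
        next
          case False
          have "(\<Sum>i | i \<in> N \<and> \<mu> i + v i \<bullet> d = \<tau>. \<alpha> i * exp (v i \<bullet> l) * (v i \<bullet> b) * (v i \<bullet> u))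
            = (\<Sum>i\<in>I. \<alpha> i * exp (v i \<bullet> l) * (v i \<bullet> b) * (v i \<bullet> u))"
            by (rule level) (use perp u in auto)
          then show ?thesis using zero b False by (auto simp: \<kappa>_def Z_def)
        qed
      qed
      ultimately have "U \<subseteq> Z" using spanB span_minimal by blast
      then have "(\<Sum>i\<in>I. \<alpha> i * exp (v i \<bullet> l) * (v i \<bullet> u) * (v i \<bullet> u)) = 0"
        using u by (auto simp: Z_def)
      moreover have "0 \<le> \<alpha> i * exp (v i \<bullet> l) * (v i \<bullet> u) * (v i \<bullet> u)" if "i \<in> I" for i
        using \<alpha>I[OF that] by (simp add: mult.assoc)
      ultimately have "\<forall>i\<in>I. \<alpha> i * exp (v i \<bullet> l) * (v i \<bullet> u) * (v i \<bullet> u) = 0"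
        using I(1) by (simp add: sum_nonneg_eq_0_iff)
      then have "v i \<bullet> u = 0" if "i \<in> I" for i
        using \<alpha>I[OF that] that by auto
      then have "u \<in> U'" using u by (simp add: U'_def)
      moreover have "(\<Sum>i | i \<in> N \<and> \<mu>' i + v i \<bullet> d1 = \<kappa>' b.
         \<alpha>' i * exp (v i \<bullet> l1) * (v i \<bullet> b) * (v i \<bullet> u)) = 0" if "b \<in> B'" for b
      proof -
        have "b \<in> B" using that B(1) by blast
        then have "(\<Sum>i | i \<in> N \<and> \<mu> i + v i \<bullet> d = \<kappa> b.
            \<alpha> i * exp (v i \<bullet> l) * (v i \<bullet> b) * (v i \<bullet> u)) = 0" using zero by blast
        then show ?thesis using that by (simp add: \<nu> a \<kappa>_def)
      qed
      ultimately show "u = 0" using inj' by blast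
    qed
    moreover have "m < \<mu> i + v i \<bullet> d" if m: "\<forall>i\<in>N. (\<exists>w\<in>U. v i \<bullet> w \<noteq> 0) \<longrightarrow> m < \<mu> i"
      and i: "i \<in> N" "\<exists>w\<in>U. v i \<bullet> w \<noteq> 0" for m i
    proof -
      have "i \<in> R" using i by (auto simp: R_def)
      then have "\<tau> \<le> \<mu> i + v i \<bullet> d" using far near by (cases "i \<in> I") (auto intro: less_imp_le)
      moreover have "m < \<tau>" using low m by (auto simp: R_def)
      ultimately show "m < \<mu> i + v i \<bullet> d" by simp
    qed
    ultimately show ?thesis by blast
  qed
qed

section \<open>Leading terms and positivity\<close>

definition puiseux_const :: "complex \<Rightarrow> puiseux" where
  "puiseux_const c = puiseux_monom c 0"

lemma puiseux_coeff_const: "puiseux_coeff (puiseux_const c) \<mu> = (if \<mu> = 0 then c else 0)"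
  by (simp add: puiseux_const_def puiseux_monom.rep_eq)

lemma puiseux_coeff_const_times: "puiseux_coeff (puiseux_const c * x) \<mu> = c * puiseux_coeff x \<mu>"
  by (simp add: puiseux_const_def puiseux_coeff_monom_times)

lemmas puiseux_coeff_simps = zero_puiseux.rep_eq one_puiseux.rep_eq plus_puiseux.rep_eq
  uminus_puiseux.rep_eq puiseux_coeff_diff puiseux_coeff_const puiseux_coeff_const_times
  puiseux_monom.rep_eq puiseux_coeff_monom_times

lemma puiseux_coeff_sum: "puiseux_coeff (sum f A) \<mu> = (\<Sum>i\<in>A. puiseux_coeff (f i) \<mu>)"
  by (induction A rule: infinite_finite_induct) (simp_all add: puiseux_coeff_simps)

lemma puiseux_const_0 [simp]: "puiseux_const 0 = 0"
  by (rule puiseux_eqI) (simp add: puiseux_coeff_simps)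

lemma puiseux_const_1 [simp]: "puiseux_const 1 = 1"
  by (rule puiseux_eqI) (simp add: puiseux_coeff_simps)

lemma puiseux_const_add: "puiseux_const (a + b) = puiseux_const a + puiseux_const b"
  by (rule puiseux_eqI) (simp add: puiseux_coeff_simps)

lemma puiseux_const_diff: "puiseux_const (a - b) = puiseux_const a - puiseux_const b"
  by (rule puiseux_eqI) (simp add: puiseux_coeff_simps)

lemma puiseux_const_mult: "puiseux_const (a * b) = puiseux_const a * puiseux_const b"
  by (rule puiseux_eqI) (simp add: puiseux_coeff_simps)

lemma puiseux_const_sum: "puiseux_const (sum f A) = (\<Sum>i\<in>A. puiseux_const (f i))"
  by (induction A rule: infinite_finite_induct) (simp_all add: puiseux_const_add)

lemma puiseux_const_of_int: "puiseux_const (of_int n) = of_int n"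
proof (induction n rule: int_induct[where k = 0])
  case (step1 i)
  then show ?case by (simp add: puiseux_const_add)
next
  case (step2 i)
  then show ?case by (simp add: puiseux_const_diff)
qed simp

lemma puiseux_monom_mult: "puiseux_monom a e * puiseux_monom b f = puiseux_monom (a * b) (e + f)"
  by (rule puiseux_eqI) (auto simp: puiseux_coeff_simps)

section \<open>The filtration by order and its completeness\<close>

definition puiseux_ge :: "real \<Rightarrow> puiseux set" where
  "puiseux_ge \<delta> = {x. \<forall>\<mu><\<delta>. puiseux_coeff x \<mu> = 0}"

lemma puiseux_ge_0 [simp]: "0 \<in> puiseux_ge \<delta>"
  by (simp add: puiseux_ge_def puiseux_coeff_simps)

lemma puiseux_ge_add: "x \<in> puiseux_ge \<delta> \<Longrightarrow> y \<in> puiseux_ge \<delta> \<Longrightarrow> x + y \<in> puiseux_ge \<delta>"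
  by (simp add: puiseux_ge_def puiseux_coeff_simps)

lemma puiseux_ge_diff: "x \<in> puiseux_ge \<delta> \<Longrightarrow> y \<in> puiseux_ge \<delta> \<Longrightarrow> x - y \<in> puiseux_ge \<delta>"
  by (simp add: puiseux_ge_def puiseux_coeff_simps)

lemma puiseux_ge_uminus: "x \<in> puiseux_ge \<delta> \<Longrightarrow> - x \<in> puiseux_ge \<delta>"
  by (simp add: puiseux_ge_def puiseux_coeff_simps)

lemma puiseux_ge_sum: "(\<And>i. i \<in> A \<Longrightarrow> f i \<in> puiseux_ge \<delta>) \<Longrightarrow> sum f A \<in> puiseux_ge \<delta>"
  by (simp add: puiseux_ge_def puiseux_coeff_sum)

lemma puiseux_ge_mult:
  "x \<in> puiseux_ge \<delta> \<Longrightarrow> y \<in> puiseux_ge \<epsilon> \<Longrightarrow> x * y \<in> puiseux_ge (\<delta> + \<epsilon>)"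
  by (simp add: puiseux_ge_def puiseux_coeff_times_eq_0)

lemma puiseux_ge_const_mult: "x \<in> puiseux_ge \<delta> \<Longrightarrow> puiseux_const c * x \<in> puiseux_ge \<delta>"
  by (simp add: puiseux_ge_def puiseux_coeff_simps)

lemma puiseux_ge_mono: "x \<in> puiseux_ge \<delta> \<Longrightarrow> \<epsilon> \<le> \<delta> \<Longrightarrow> x \<in> puiseux_ge \<epsilon>"
  by (auto simp: puiseux_ge_def)

lemma puiseux_ge_mult_0: "x \<in> puiseux_ge 0 \<Longrightarrow> y \<in> puiseux_ge \<delta> \<Longrightarrow> x * y \<in> puiseux_ge \<delta>"
  using puiseux_ge_mult[of x 0 y \<delta>] by simp

lemma puiseux_ge_all_imp_0:
  assumes \<delta>: "\<delta> > 0" and x: "\<And>n. x \<in> puiseux_ge (real (Suc n) * \<delta>)"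
  shows "x = 0"
proof (rule puiseux_eqI)
  fix \<mu>
  obtain n where "\<mu> / \<delta> < real n" using reals_Archimedean2 by blast
  then have "\<mu> < real (Suc n) * \<delta>" using \<delta> by (simp add: field_simps)
  then show "puiseux_coeff x \<mu> = puiseux_coeff 0 \<mu>"
    using x[of n] by (simp add: puiseux_ge_def puiseux_coeff_simps)
qed

text \<open>Each nonzero member has a positive least exponent, and finitely many of them have a
  common positive lower bound. This supplies the uniform gap for the Newton iteration.\<close>

lemma puiseux_ge_pos_exists:
  assumes "finite X" "\<And>x \<mu>. x \<in> X \<Longrightarrow> \<mu> \<le> 0 \<Longrightarrow> puiseux_coeff x \<mu> = 0"
  obtains \<delta> where "\<delta> > 0" "X \<subseteq> puiseux_ge \<delta>"
proof -
  have "\<exists>\<delta>>0. X \<subseteq> puiseux_ge \<delta>"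
    using assms
  proof (induction X rule: finite_induct)
    case empty
    then show ?case by (auto intro: exI[of _ 1])
  next
    case (insert x X)
    then obtain \<delta> where \<delta>: "\<delta> > 0" "X \<subseteq> puiseux_ge \<delta>" by auto
    have "\<exists>\<epsilon>>0. x \<in> puiseux_ge \<epsilon>"
    proof (cases "x = 0")
      case True
      then show ?thesis by (auto intro: exI[of _ 1])
    next
      case False
      then obtain a where a: "puiseux_coeff x a \<noteq> 0" "\<forall>\<mu><a. puiseux_coeff x \<mu> = 0"
        using puiseux_least_exponent by blast
      then have "a > 0" using insert.prems[of x a] by force
      then show ?thesis using a by (auto simp: puiseux_ge_def)
    qed
    then obtain \<epsilon> where "\<epsilon> > 0" "x \<in> puiseux_ge \<epsilon>" by blast
    then show ?case using \<delta>
      by (intro exI[of _ "min \<delta> \<epsilon>"]) (auto intro: puiseux_ge_mono)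
  qed
  then show ?thesis using that by blast
qed

text \<open>The coefficient at each exponent is eventually constant, and the limit is taken
  coefficientwise. Below any bound it agrees with a single \<open>z n\<close>, so its support is
  again left-finite.\<close>

lemma puiseux_complete:
  fixes z :: "nat \<Rightarrow> puiseux"
  assumes \<delta>: "\<delta> > 0" and z: "\<And>n. z (Suc n) - z n \<in> puiseux_ge (real (Suc n) * \<delta>)"
  obtains x where "\<And>n. x - z n \<in> puiseux_ge (real (Suc n) * \<delta>)"
proof -
  have stable: "puiseux_coeff (z m) \<mu> = puiseux_coeff (z n) \<mu>"
    if "n \<le> m" "\<mu> < real (Suc n) * \<delta>" for m n \<mu>
    using that(1)
  proof (induction m rule: dec_induct)
    case (step m)
    have "real (Suc n) * \<delta> \<le> real (Suc m) * \<delta>" using step(1) \<delta> by (intro mult_right_mono) auto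
    then have "puiseux_coeff (z (Suc m) - z m) \<mu> = 0"
      using z[of m] that(2) by (auto simp: puiseux_ge_def)
    then show ?case using step by (simp add: puiseux_coeff_simps)
  qed simp
  \<comment> \<open>An index from which the coefficient at \<mu> no longer changes.\<close>
  define N where "N \<mu> = nat \<lceil>\<mu> / \<delta>\<rceil>" for \<mu>
  have N: "\<mu> < real (Suc (N \<mu>)) * \<delta>" for \<mu>
  proof -
    have "\<mu> / \<delta> < real (Suc (N \<mu>))" unfolding N_def by linarith
    then show ?thesis using \<delta> by (simp add: pos_divide_less_eq)
  qed
  define c where "c \<mu> = puiseux_coeff (z (N \<mu>)) \<mu>" for \<mu>
  have c: "c \<mu> = puiseux_coeff (z n) \<mu>" if "\<mu> < real (Suc n) * \<delta>" for \<mu> n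
    unfolding c_def using stable[OF _ that, of "N \<mu>"] stable[OF _ N, of \<mu> n] by (cases "n \<le> N \<mu>") auto
  have supp: "puiseux_support {\<mu>. c \<mu> \<noteq> 0}"
    unfolding puiseux_support_iff
  proof
    fix B
    have "c \<mu> = puiseux_coeff (z (N B)) \<mu>" if "\<mu> \<le> B" for \<mu>
      using c[of \<mu> "N B"] N[of B] that by simp
    then show "finite {\<mu> \<in> {\<mu>. c \<mu> \<noteq> 0}. \<mu> \<le> B}"
      by (intro finite_subset[OF _ finite_puiseux_coeff[of "z (N B)" B]]) auto
  qed
  have "puiseux_coeff (Abs_puiseux c) = c" using supp by (simp add: Abs_puiseux_inverse)
  then show ?thesis using c by (intro that[of "Abs_puiseux c"]) (simp add: puiseux_ge_def puiseux_coeff_simps)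
qed

section \<open>Leading terms\<close>

text \<open>The coefficient \<open>c\<close> may vanish, so that leading terms multiply without case
  distinctions.\<close>

definition puiseux_leads :: "puiseux \<Rightarrow> real \<Rightarrow> complex \<Rightarrow> bool" where
  "puiseux_leads x e c \<longleftrightarrow> puiseux_coeff x e = c \<and> (\<forall>\<mu><e. puiseux_coeff x \<mu> = 0)"

text \<open>At exponent \<open>e + f\<close> only the pair \<open>(e, f)\<close> contributes, as
  both series vanish below.\<close>

lemma puiseux_leads_mult:
  assumes "puiseux_leads x e c" "puiseux_leads y f d"
  shows "puiseux_leads (x * y) (e + f) (c * d)"
proof -
  have "\<alpha> \<in> {e}" if "puiseux_coeff x \<alpha> \<noteq> 0" "puiseux_coeff y (e + f - \<alpha>) \<noteq> 0" for \<alpha>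
  proof -
    have "\<not> \<alpha> < e" "\<not> e + f - \<alpha> < f" using assms that unfolding puiseux_leads_def by blast+
    then show ?thesis by simp
  qed
  then have "puiseux_coeff (x * y) (e + f) = (\<Sum>\<alpha>\<in>{e}. puiseux_coeff x \<alpha> * puiseux_coeff y (e + f - \<alpha>))"
    by (intro puiseux_coeff_times) auto
  moreover have "\<forall>\<mu><e+f. puiseux_coeff (x * y) \<mu> = 0"
    using assms puiseux_coeff_times_eq_0 unfolding puiseux_leads_def by blast
  ultimately show ?thesis using assms by (simp add: puiseux_leads_def)
qed

lemma puiseux_leads_const: "puiseux_leads (puiseux_const c) 0 c"
  by (simp add: puiseux_leads_def puiseux_coeff_simps)

lemma puiseux_leads_1: "puiseux_leads 1 0 1"
  by (simp add: puiseux_leads_def puiseux_coeff_simps)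

lemma puiseux_leads_unique:
  assumes "puiseux_leads x e c" "puiseux_leads x f d" "c \<noteq> 0" "d \<noteq> 0"
  shows "e = f" "c = d"
proof -
  show "e = f" using assms unfolding puiseux_leads_def by (meson linorder_neqE_linordered_idom)
  then show "c = d" using assms by (simp add: puiseux_leads_def)
qed

lemma puiseux_leads_nonzero: "puiseux_leads x e c \<Longrightarrow> c \<noteq> 0 \<Longrightarrow> x \<noteq> 0"
  by (auto simp: puiseux_leads_def puiseux_coeff_simps)

lemma puiseux_leads_exists:
  assumes "x \<noteq> 0"
  obtains e c where "puiseux_leads x e c" "c \<noteq> 0"
  using puiseux_least_exponent[OF assms] that unfolding puiseux_leads_def by blast

lemma puiseux_leads_inverse:
  assumes "puiseux_leads x e c" "c \<noteq> 0"
  shows "puiseux_leads (inverse x) (- e) (inverse c)"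
proof -
  have x: "x \<noteq> 0" using assms by (rule puiseux_leads_nonzero)
  then obtain f d where fd: "puiseux_leads (inverse x) f d" "d \<noteq> 0"
    using puiseux_leads_exists[of "inverse x"] by auto
  have "puiseux_leads 1 (e + f) (c * d)" using puiseux_leads_mult[OF assms(1) fd(1)] x by simp
  then have "e + f = 0" "c * d = 1"
    using puiseux_leads_unique[OF _ puiseux_leads_1] assms fd by auto
  then have "f = - e" "d = inverse c" by (simp_all add: inverse_unique)
  then show ?thesis using fd(1) by simp
qed

lemma puiseux_leads_power:
  "puiseux_leads x e c \<Longrightarrow> puiseux_leads (x ^ n) (real n * e) (c ^ n)"
proof (induction n)
  case (Suc n)
  then have "puiseux_leads (x * x ^ n) (e + real n * e) (c * c ^ n)" by (intro puiseux_leads_mult)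
  then show ?case by (simp add: algebra_simps)
qed (simp add: puiseux_leads_1)

lemma puiseux_leads_power_int:
  assumes "puiseux_leads x e c" "c \<noteq> 0"
  shows "puiseux_leads (x powi n) (of_int n * e) (c powi n)"
proof (cases "n \<ge> 0")
  case True
  then show ?thesis using puiseux_leads_power[OF assms(1), of "nat n"] by (simp add: power_int_def)
next
  case False
  then show ?thesis
    using puiseux_leads_power[OF puiseux_leads_inverse[OF assms], of "nat (- n)"]
    by (simp add: power_int_def)
qed

lemma puiseux_leads_prod:
  "(\<And>j. j \<in> A \<Longrightarrow> puiseux_leads (x j) (e j) (c j)) \<Longrightarrow>
    puiseux_leads (prod x A) (sum e A) (prod c A)"
  by (induction A rule: infinite_finite_induct) (simp_all add: puiseux_leads_1 puiseux_leads_mult)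

section \<open>Positive elements\<close>

text \<open>Trades the \<open>LEAST\<close> exponent of the definition for a witnessed leading term,
  the form in which products, inverses and sums are computed.\<close>

lemma puiseux_pos_iff:
  "x \<in> puiseux_pos \<longleftrightarrow> (\<exists>e c. c > 0 \<and> puiseux_leads x e (of_real c))"
proof
  assume x: "x \<in> puiseux_pos"
  then obtain e c where ec: "puiseux_leads x e c" "c \<noteq> 0"
    using puiseux_leads_exists[of x] by (auto simp: puiseux_pos_def)
  have "(LEAST \<mu>. puiseux_coeff x \<mu> \<noteq> 0) = e"
    using ec by (intro Least_equality) (auto simp: puiseux_leads_def not_less[symmetric])
  then have "puiseux_lead_coeff x = c" using ec by (simp add: puiseux_lead_coeff_def puiseux_leads_def)
  then have "of_real (Re c) = c" "Re c > 0" using x by (auto simp: puiseux_pos_def)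
  then show "\<exists>e c. c > 0 \<and> puiseux_leads x e (of_real c)" using ec by metis
next
  assume "\<exists>e c. c > 0 \<and> puiseux_leads x e (of_real c)"
  then obtain e c where ec: "c > 0" "puiseux_leads x e (of_real c)" by blast
  have "(LEAST \<mu>. puiseux_coeff x \<mu> \<noteq> 0) = e"
    using ec by (intro Least_equality) (auto simp: puiseux_leads_def not_less[symmetric])
  then have "puiseux_lead_coeff x = of_real c"
    using ec by (simp add: puiseux_lead_coeff_def puiseux_leads_def)
  then show "x \<in> puiseux_pos"
    using ec puiseux_leads_nonzero[OF ec(2)] by (simp add: puiseux_pos_def)
qed

lemma puiseux_pos_nonzero: "x \<in> puiseux_pos \<Longrightarrow> x \<noteq> 0"
  by (simp add: puiseux_pos_def)

lemma puiseux_pos_mult: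
  assumes "x \<in> puiseux_pos" "y \<in> puiseux_pos"
  shows "x * y \<in> puiseux_pos"
proof -
  obtain e c f d where "c > 0" "puiseux_leads x e (of_real c)" "d > 0" "puiseux_leads y f (of_real d)"
    using assms unfolding puiseux_pos_iff by blast
  then show ?thesis unfolding puiseux_pos_iff
    using puiseux_leads_mult[of x e "of_real c" y f "of_real d"]
    by (intro exI[of _ "e + f"] exI[of _ "c * d"]) auto
qed

lemma puiseux_pos_inverse:
  assumes "x \<in> puiseux_pos"
  shows "inverse x \<in> puiseux_pos"
proof -
  obtain e c where "c > 0" "puiseux_leads x e (of_real c)"
    using assms unfolding puiseux_pos_iff by blast
  then show ?thesis unfolding puiseux_pos_iff
    using puiseux_leads_inverse[of x e "of_real c"]
    by (intro exI[of _ "- e"] exI[of _ "inverse c"]) auto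
qed

lemma puiseux_pos_1: "1 \<in> puiseux_pos"
  unfolding puiseux_pos_iff using puiseux_leads_1 by (intro exI[of _ 0] exI[of _ 1]) simp

lemma puiseux_pos_power: "x \<in> puiseux_pos \<Longrightarrow> x ^ n \<in> puiseux_pos"
  by (induction n) (auto intro: puiseux_pos_1 puiseux_pos_mult)

lemma puiseux_pos_power_int: "x \<in> puiseux_pos \<Longrightarrow> x powi n \<in> puiseux_pos"
  by (auto simp: power_int_def intro: puiseux_pos_power puiseux_pos_inverse)

lemma puiseux_pos_prod: "(\<And>j. j \<in> A \<Longrightarrow> x j \<in> puiseux_pos) \<Longrightarrow> prod x A \<in> puiseux_pos"
  by (induction A rule: infinite_finite_induct) (auto intro: puiseux_pos_1 puiseux_pos_mult)

text \<open>The leading term of lower order survives; at equal orders the positive coefficients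
  cannot cancel.\<close>

lemma puiseux_pos_add:
  assumes "x \<in> puiseux_pos" "y \<in> puiseux_pos"
  shows "x + y \<in> puiseux_pos"
proof -
  obtain e c f d where *: "c > 0" "puiseux_leads x e (of_real c)" "d > 0" "puiseux_leads y f (of_real d)"
    using assms unfolding puiseux_pos_iff by blast
  show ?thesis
  proof (cases e f rule: linorder_cases)
    case less
    then have "puiseux_leads (x + y) e (of_real c)" using * by (simp add: puiseux_leads_def puiseux_coeff_simps)
    then show ?thesis using * unfolding puiseux_pos_iff by blast
  next
    case equal
    then have "puiseux_leads (x + y) e (of_real (c + d))" using * by (simp add: puiseux_leads_def puiseux_coeff_simps)
    moreover have "c + d > 0" using * by simp
    ultimately show ?thesis unfolding puiseux_pos_iff by blast
  next
    case greater
    then have "puiseux_leads (x + y) f (of_real d)" using * by (simp add: puiseux_leads_def puiseux_coeff_simps)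
    then show ?thesis using * unfolding puiseux_pos_iff by blast
  qed
qed

text \<open>A sum of zero or positive elements is positive as soon as one summand is, and positive
  elements are nonzero. Uniqueness rests on this absence of cancellation.\<close>

lemma puiseux_pos_sum_eq_0:
  assumes "finite A" "\<And>i. i \<in> A \<Longrightarrow> f i = 0 \<or> f i \<in> puiseux_pos" "sum f A = 0" "i \<in> A"
  shows "f i = 0"
proof -
  have "(\<forall>i\<in>A. f i = 0) \<or> sum f A \<in> puiseux_pos" using assms(1,2)
  proof (induction A rule: finite_induct)
    case (insert i A)
    then have "f i = 0 \<or> f i \<in> puiseux_pos" "(\<forall>i\<in>A. f i = 0) \<or> sum f A \<in> puiseux_pos" by simp_all
    then show ?case using insert.hyps by (auto intro: puiseux_pos_add)
  qed simp
  then show ?thesis using assms(3,4) puiseux_pos_nonzero by auto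
qed

section \<open>Hensel's lemma\<close>

text \<open>\<open>l\<close> is the first-order approximation of the difference of two units
  \<open>a, b \<in> 1 + O(\<delta>)\<close>.\<close>

definition puiseux_tangent :: "real \<Rightarrow> real \<Rightarrow> puiseux \<Rightarrow> puiseux \<Rightarrow> puiseux \<Rightarrow> bool" where
  "puiseux_tangent \<delta> \<epsilon> a b l \<longleftrightarrow>
    a - 1 \<in> puiseux_ge \<delta> \<and> b - 1 \<in> puiseux_ge \<delta> \<and> l \<in> puiseux_ge \<epsilon> \<and> a - b - l \<in> puiseux_ge (\<delta> + \<epsilon>)"

lemma puiseux_leads_one_plus:
  assumes "\<delta> > 0" "a - 1 \<in> puiseux_ge \<delta>"
  shows "puiseux_leads a 0 1"
proof -
  have "puiseux_coeff (a - 1) \<mu> = 0" if "\<mu> < \<delta>" for \<mu>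
    using assms that by (auto simp: puiseux_ge_def)
  then have "puiseux_coeff a \<mu> = (if \<mu> = 0 then 1 else 0)" if "\<mu> < \<delta>" for \<mu>
    using that by (simp add: puiseux_coeff_simps split: if_splits)
  then show ?thesis using assms(1) by (simp add: puiseux_leads_def)
qed

lemma puiseux_leads_ge: "puiseux_leads a e c \<Longrightarrow> \<delta> \<le> e \<Longrightarrow> a \<in> puiseux_ge \<delta>"
  by (auto simp: puiseux_leads_def puiseux_ge_def)

lemma puiseux_inverse_one_plus:
  assumes \<delta>: "\<delta> > 0" and a: "a - 1 \<in> puiseux_ge \<delta>"
  shows "inverse a - 1 \<in> puiseux_ge \<delta>"
proof -
  have lead: "puiseux_leads a 0 1" using puiseux_leads_one_plus[OF assms] .
  then have "a \<noteq> 0" by (rule puiseux_leads_nonzero) simp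
  then have "inverse a - 1 = - (inverse a * (a - 1))" by (simp add: algebra_simps)
  moreover have "inverse a \<in> puiseux_ge 0"
    using puiseux_leads_ge[OF puiseux_leads_inverse[OF lead]] by simp
  ultimately show ?thesis using a by (simp add: puiseux_ge_uminus puiseux_ge_mult_0)
qed

lemma puiseux_tangent_1: "puiseux_tangent \<delta> \<epsilon> 1 1 0"
  by (simp add: puiseux_tangent_def)

text \<open>All factors lie in 1 + O(\<delta>), so replacing one of them by 1 next to a term of
  order \<epsilon> costs only order \<delta> + \<epsilon>; the first-order parts therefore
  add.\<close>

lemma puiseux_tangent_mult:
  assumes \<delta>: "\<delta> > 0" and "puiseux_tangent \<delta> \<epsilon> a b l" "puiseux_tangent \<delta> \<epsilon> a' b' l'"
  shows "puiseux_tangent \<delta> \<epsilon> (a * a') (b * b') (l + l')"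
proof -
  have ge0: "x \<in> puiseux_ge 0" if "x - 1 \<in> puiseux_ge \<delta>" for x
    using puiseux_leads_ge[OF puiseux_leads_one_plus[OF \<delta> that]] by simp
  have one: "x * y - 1 \<in> puiseux_ge \<delta>" if "x - 1 \<in> puiseux_ge \<delta>" "y - 1 \<in> puiseux_ge \<delta>" for x y
  proof -
    have "x * y - 1 = x * (y - 1) + (x - 1)" by (simp add: algebra_simps)
    also have "\<dots> \<in> puiseux_ge \<delta>" by (intro puiseux_ge_add puiseux_ge_mult_0 ge0 that)
    finally show ?thesis .
  qed
  have "a * a' - b * b' - (l + l') =
      a' * (a - b - l) + (a' - 1) * l + b * (a' - b' - l') + (b - 1) * l'"
    by (simp add: algebra_simps)
  also have "\<dots> \<in> puiseux_ge (\<delta> + \<epsilon>)"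
    using assms ge0 unfolding puiseux_tangent_def
    by (intro puiseux_ge_add puiseux_ge_mult_0 puiseux_ge_mult) auto
  finally show ?thesis
    using assms one unfolding puiseux_tangent_def by (auto intro: puiseux_ge_add)
qed

text \<open>The derivative of the inverse at 1 is -1, and on 1 + O(\<delta>) the deviation from it
  has order \<delta>.\<close>

lemma puiseux_tangent_inverse:
  assumes \<delta>: "\<delta> > 0" and t: "puiseux_tangent \<delta> \<epsilon> a b l"
  shows "puiseux_tangent \<delta> \<epsilon> (inverse a) (inverse b) (- l)"
proof -
  have inv: "inverse x - 1 \<in> puiseux_ge \<delta>" "x \<noteq> 0" "inverse x \<in> puiseux_ge 0"
    if "x - 1 \<in> puiseux_ge \<delta>" for x
  proof -
    have lead: "puiseux_leads x 0 1" using puiseux_leads_one_plus[OF \<delta> that] .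
    show "inverse x - 1 \<in> puiseux_ge \<delta>" using puiseux_inverse_one_plus[OF \<delta> that] .
    show "x \<noteq> 0" using lead by (rule puiseux_leads_nonzero) simp
    show "inverse x \<in> puiseux_ge 0" using puiseux_leads_ge[OF puiseux_leads_inverse[OF lead]] by simp
  qed
  have ab: "a - 1 \<in> puiseux_ge \<delta>" "b - 1 \<in> puiseux_ge \<delta>" "l \<in> puiseux_ge \<epsilon>"
    "a - b - l \<in> puiseux_ge (\<delta> + \<epsilon>)"
    using t by (auto simp: puiseux_tangent_def)
  have nz: "a \<noteq> 0" "b \<noteq> 0" using ab inv by auto
  let ?A = "inverse a" and ?B = "inverse b"
  have "?A - ?B = - (?A * ?B * (a - b))" using nz by (simp add: algebra_simps)
  then have "?A - ?B - - l = - (?A * ?B * (a - b - l)) - (?A - 1) * (?B * l) - (?B - 1) * l"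
    by (simp add: algebra_simps)
  also have "\<dots> \<in> puiseux_ge (\<delta> + \<epsilon>)"
  proof (intro puiseux_ge_diff puiseux_ge_uminus)
    show "?A * ?B * (a - b - l) \<in> puiseux_ge (\<delta> + \<epsilon>)"
      unfolding mult.assoc using ab inv by (intro puiseux_ge_mult_0) auto
    show "(?A - 1) * (?B * l) \<in> puiseux_ge (\<delta> + \<epsilon>)"
      by (rule puiseux_ge_mult[OF inv(1)[OF ab(1)] puiseux_ge_mult_0[OF inv(3)[OF ab(2)] ab(3)]])
    show "(?B - 1) * l \<in> puiseux_ge (\<delta> + \<epsilon>)"
      by (rule puiseux_ge_mult[OF inv(1)[OF ab(2)] ab(3)])
  qed
  finally show ?thesis using ab inv by (simp add: puiseux_tangent_def puiseux_ge_uminus)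
qed

lemma puiseux_tangent_power:
  assumes "\<delta> > 0" "puiseux_tangent \<delta> \<epsilon> a b l"
  shows "puiseux_tangent \<delta> \<epsilon> (a ^ n) (b ^ n) (of_nat n * l)"
proof (induction n)
  case (Suc n)
  then have "puiseux_tangent \<delta> \<epsilon> (a * a ^ n) (b * b ^ n) (l + of_nat n * l)"
    using assms by (intro puiseux_tangent_mult)
  then show ?case by (simp add: algebra_simps)
qed (simp add: puiseux_tangent_1)

lemma puiseux_tangent_power_int:
  assumes "\<delta> > 0" "puiseux_tangent \<delta> \<epsilon> a b l"
  shows "puiseux_tangent \<delta> \<epsilon> (a powi n) (b powi n) (of_int n * l)"
proof (cases "n \<ge> 0")
  case True
  then show ?thesis using puiseux_tangent_power[OF assms, of "nat n"] by (simp add: power_int_def)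
next
  case False
  then show ?thesis
    using puiseux_tangent_power[OF assms(1) puiseux_tangent_inverse[OF assms], of "nat (- n)"]
    by (simp add: power_int_def)
qed

lemma puiseux_tangent_prod:
  assumes "\<delta> > 0" "\<And>j. j \<in> A \<Longrightarrow> puiseux_tangent \<delta> \<epsilon> (a j) (b j) (l j)"
  shows "puiseux_tangent \<delta> \<epsilon> (prod a A) (prod b A) (sum l A)"
  using assms(2)
  by (induction A rule: infinite_finite_induct)
    (simp_all add: puiseux_tangent_1 puiseux_tangent_mult assms(1))

text \<open>At the point 1 the monomial with exponent \<open>v\<close> has gradient
  \<open>v\<close>.\<close>

lemma puiseux_tangent_monomial:
  fixes z w :: "'r::finite \<Rightarrow> puiseux" and v :: "int ^ 'r"
  assumes "\<delta> > 0" "\<And>l. z l \<in> puiseux_ge \<delta>" "\<And>l. w l \<in> puiseux_ge \<delta>"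
    "\<And>l. z l - w l \<in> puiseux_ge \<epsilon>"
  shows "puiseux_tangent \<delta> \<epsilon> (\<Prod>l\<in>UNIV. (1 + z l) powi (v $ l)) (\<Prod>l\<in>UNIV. (1 + w l) powi (v $ l))
    (\<Sum>l\<in>UNIV. of_int (v $ l) * (z l - w l))"
proof (intro puiseux_tangent_prod puiseux_tangent_power_int assms(1))
  show "puiseux_tangent \<delta> \<epsilon> (1 + z l) (1 + w l) (z l - w l)" for l
    using assms by (simp add: puiseux_tangent_def)
qed

text \<open>Hensel's lemma, by the Newton iteration with the fixed Jacobian at the residue field, which is
  a contraction of \<open>O(\<delta>)\<close>.\<close>

lemma puiseux_hensel:
  fixes h :: "'i \<Rightarrow> 'r::finite \<Rightarrow> puiseux" and v :: "'i \<Rightarrow> int ^ 'r"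
  assumes N: "finite N" and h0: "\<And>i j. i \<in> N \<Longrightarrow> h i j \<in> puiseux_ge 0"
    and res: "\<And>j. (\<Sum>i\<in>N. puiseux_coeff (h i j) 0) = 0"
    and J: "invertible (\<chi> j l. \<Sum>i\<in>N. puiseux_coeff (h i j) 0 * of_int (v i $ l) :: complex ^ 'r ^ 'r)"
  shows "\<exists>z. (\<exists>\<delta>>0. \<forall>l. z l \<in> puiseux_ge \<delta>) \<and>
    (\<forall>j. (\<Sum>i\<in>N. h i j * (\<Prod>l\<in>UNIV. (1 + z l) powi (v i $ l))) = 0)"
proof -
  \<comment> \<open>\<open>r\<close> is the residue of \<open>h\<close>. The finitely many
    remainders have positive order, hence a common \<delta>, which becomes the gain of the
    contraction.\<close>
  define r where "r i j = puiseux_const (puiseux_coeff (h i j) 0)" for i j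
  have fin: "finite ((\<lambda>(i, j). h i j - r i j) ` (N \<times> UNIV))" using N by simp
  have "puiseux_coeff (h i j - r i j) \<mu> = 0" if "i \<in> N" "\<mu> \<le> 0" for i j \<mu>
    using h0[OF that(1), of j] that(2) by (cases "\<mu> = 0") (auto simp: r_def puiseux_coeff_simps puiseux_ge_def)
  then have "puiseux_coeff x \<mu> = 0" if "x \<in> (\<lambda>(i, j). h i j - r i j) ` (N \<times> UNIV)" "\<mu> \<le> 0" for x \<mu>
    using that by auto
  from puiseux_ge_pos_exists[OF fin this]
  obtain \<delta> where \<delta>: "\<delta> > 0" and sub: "(\<lambda>(i, j). h i j - r i j) ` (N \<times> UNIV) \<subseteq> puiseux_ge \<delta>"
    by blast
  have hr: "h i j - r i j \<in> puiseux_ge \<delta>" if "i \<in> N" for i j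
    using sub that by force
  define J where "J = (\<chi> j l. \<Sum>i\<in>N. puiseux_coeff (h i j) 0 * of_int (v i $ l) :: complex ^ 'r ^ 'r)"
  obtain D where D: "J ** D = mat 1" "D ** J = mat 1"
    using J unfolding J_def[symmetric] invertible_def by blast
  define C' where "C' j l = puiseux_const (J $ j $ l)" for j l
  define D' where "D' j l = puiseux_const (D $ j $ l)" for j l
  have CD: "(\<Sum>k\<in>UNIV. C' j k * D' k l) = (if j = l then 1 else 0)" for j l
  proof -
    have "(\<Sum>k\<in>UNIV. J $ j $ k * D $ k $ l) = (J ** D) $ j $ l" by (simp add: matrix_matrix_mult_def)
    also have "\<dots> = (if j = l then 1 else 0)" by (simp add: D mat_def)
    finally show ?thesis
      unfolding C'_def D'_def puiseux_const_mult[symmetric] puiseux_const_sum[symmetric] by simp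
  qed
  have DC: "(\<Sum>k\<in>UNIV. D' j k * C' k l) = (if j = l then 1 else 0)" for j l
  proof -
    have "(\<Sum>k\<in>UNIV. D $ j $ k * J $ k $ l) = (D ** J) $ j $ l" by (simp add: matrix_matrix_mult_def)
    also have "\<dots> = (if j = l then 1 else 0)" by (simp add: D mat_def)
    finally show ?thesis
      unfolding C'_def D'_def puiseux_const_mult[symmetric] puiseux_const_sum[symmetric] by simp
  qed
  have D'ge: "D' j k * x \<in> puiseux_ge \<epsilon>" if "x \<in> puiseux_ge \<epsilon>" for j k x \<epsilon>
    unfolding D'_def using that by (rule puiseux_ge_const_mult)
  define E where "E i z = (\<Prod>l\<in>UNIV. (1 + z l) powi (v i $ l))" for i and z :: "'r \<Rightarrow> puiseux"
  define \<Phi> where "\<Phi> z j = (\<Sum>i\<in>N. h i j * E i z)" for z j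
  \<comment> \<open>Two errors separate \<Phi> from its residue linearisation: the nonlinearity of
    the monomials and the difference between \<open>h\<close> and its residue. Each gains order
    \<delta>.\<close>
  have lin: "\<Phi> z j - \<Phi> w j - (\<Sum>l\<in>UNIV. C' j l * (z l - w l)) \<in> puiseux_ge (\<delta> + \<epsilon>)"
    if z: "\<And>l. z l \<in> puiseux_ge \<delta>" and w: "\<And>l. w l \<in> puiseux_ge \<delta>"
      and zw: "\<And>l. z l - w l \<in> puiseux_ge \<epsilon>" for z w \<epsilon> j
  proof -
    define L where "L i = (\<Sum>l\<in>UNIV. of_int (v i $ l) * (z l - w l))" for i
    have t: "puiseux_tangent \<delta> \<epsilon> (E i z) (E i w) (L i)" for i
      unfolding E_def L_def using \<delta> z w zw by (rule puiseux_tangent_monomial)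
    have "(\<Sum>l\<in>UNIV. C' j l * (z l - w l)) = (\<Sum>l\<in>UNIV. \<Sum>i\<in>N. r i j * of_int (v i $ l) * (z l - w l))"
      by (simp add: C'_def J_def r_def puiseux_const_sum puiseux_const_mult puiseux_const_of_int
          sum_distrib_right)
    also have "\<dots> = (\<Sum>i\<in>N. r i j * L i)"
      unfolding L_def sum_distrib_left by (subst sum.swap) (simp add: mult.assoc)
    finally have "\<Phi> z j - \<Phi> w j - (\<Sum>l\<in>UNIV. C' j l * (z l - w l))
        = (\<Sum>i\<in>N. h i j * (E i z - E i w - L i) + (h i j - r i j) * L i)"
      unfolding \<Phi>_def by (simp add: sum_subtractf[symmetric] algebra_simps)
    also have "\<dots> \<in> puiseux_ge (\<delta> + \<epsilon>)"
      using t h0 hr unfolding puiseux_tangent_def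
      by (intro puiseux_ge_sum puiseux_ge_add puiseux_ge_mult_0 puiseux_ge_mult) auto
    finally show ?thesis .
  qed
  \<comment> \<open>The Newton map with fixed inverse Jacobian \<open>D'\<close>. Since
    \<open>D'\<close> inverts \<open>C'\<close>, the linear part of \<Phi> cancels in differences of
    \<open>T\<close> and only the error from \<open>lin\<close> remains.\<close>
  define T where "T z l = z l - (\<Sum>k\<in>UNIV. D' l k * \<Phi> z k)" for z l
  have contr: "T z l - T w l \<in> puiseux_ge (\<delta> + \<epsilon>)"
    if z: "\<And>l. z l \<in> puiseux_ge \<delta>" and w: "\<And>l. w l \<in> puiseux_ge \<delta>"
      and zw: "\<And>l. z l - w l \<in> puiseux_ge \<epsilon>" for z w \<epsilon> l
  proof -
    have "(\<Sum>k\<in>UNIV. D' l k * (\<Sum>m\<in>UNIV. C' k m * (z m - w m)))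
        = (\<Sum>m\<in>UNIV. (\<Sum>k\<in>UNIV. D' l k * C' k m) * (z m - w m))"
      unfolding sum_distrib_left sum_distrib_right by (subst sum.swap) (simp add: mult.assoc)
    also have "\<dots> = (\<Sum>m\<in>UNIV. if l = m then z m - w m else 0)"
      unfolding DC by (intro sum.cong) auto
    also have "\<dots> = z l - w l" by simp
    finally have "T z l - T w l =
      - (\<Sum>k\<in>UNIV. D' l k * (\<Phi> z k - \<Phi> w k - (\<Sum>m\<in>UNIV. C' k m * (z m - w m))))"
      unfolding T_def by (simp add: right_diff_distrib sum_subtractf)
    then show ?thesis
      using lin[OF z w zw] by (simp add: puiseux_ge_uminus puiseux_ge_sum D'ge)
  qed
  have \<Phi>0: "\<Phi> (\<lambda>_. 0) j \<in> puiseux_ge \<delta>" for j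
  proof -
    have "(\<Sum>i\<in>N. r i j) = 0" unfolding r_def puiseux_const_sum[symmetric] res by simp
    then have "\<Phi> (\<lambda>_. 0) j = (\<Sum>i\<in>N. h i j - r i j)" by (simp add: \<Phi>_def E_def sum_subtractf)
    also have "\<dots> \<in> puiseux_ge \<delta>" using hr by (rule puiseux_ge_sum)
    finally show ?thesis .
  qed
  have T0: "T (\<lambda>_. 0) l \<in> puiseux_ge \<delta>" for l
    unfolding T_def using \<Phi>0 by (simp add: puiseux_ge_uminus puiseux_ge_sum D'ge)
  have T_ge: "T z l \<in> puiseux_ge \<delta>" if "\<And>l. z l \<in> puiseux_ge \<delta>" for z l
  proof -
    have "T z l - T (\<lambda>_. 0) l \<in> puiseux_ge (\<delta> + \<delta>)" using that by (intro contr) auto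
    then have "T z l - T (\<lambda>_. 0) l \<in> puiseux_ge \<delta>" by (rule puiseux_ge_mono) (use \<delta> in simp)
    from puiseux_ge_add[OF this T0[of l]] show ?thesis by simp
  qed
  define s where "s n = (T ^^ n) (\<lambda>_. 0)" for n
  have s_Suc: "s (Suc n) = T (s n)" for n by (simp add: s_def)
  have s_ge: "s n l \<in> puiseux_ge \<delta>" for n l
    by (induction n arbitrary: l) (simp_all add: s_Suc T_ge, simp add: s_def)
  have step: "s (Suc n) l - s n l \<in> puiseux_ge (real (Suc n) * \<delta>)" for n l
  proof (induction n arbitrary: l)
    case 0
    show ?case using T0 by (simp add: s_def)
  next
    case (Suc n)
    have "T (s (Suc n)) l - T (s n) l \<in> puiseux_ge (\<delta> + real (Suc n) * \<delta>)"
      by (rule contr[OF s_ge s_ge Suc])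
    then show ?case by (simp add: s_Suc algebra_simps)
  qed
  have "\<exists>x. \<forall>n. x - s n l \<in> puiseux_ge (real (Suc n) * \<delta>)" for l
    using puiseux_complete[OF \<delta>, of "\<lambda>n. s n l"] step by metis
  then obtain z where z: "\<And>l n. z l - s n l \<in> puiseux_ge (real (Suc n) * \<delta>)" by metis
  have z_ge: "z l \<in> puiseux_ge \<delta>" for l using z[of l 0] by (simp add: s_def)
  have fixed: "T z l = z l" for l
  proof -
    \<comment> \<open>Both \<open>T z\<close> and \<open>z\<close> agree with the iterate
      \<open>s (Suc n)\<close> up to order \<open>real (Suc n) * \<delta>\<close>, for every
      \<open>n\<close>.\<close>
    have "T z l - z l \<in> puiseux_ge (real (Suc n) * \<delta>)" for n
    proof -
      have le: "real (Suc n) * \<delta> \<le> \<delta> + real (Suc n) * \<delta>" using \<delta> by simp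
      have "T z l - T (s n) l \<in> puiseux_ge (\<delta> + real (Suc n) * \<delta>)"
        by (rule contr[OF z_ge s_ge z])
      then have a: "T z l - s (Suc n) l \<in> puiseux_ge (real (Suc n) * \<delta>)"
        unfolding s_Suc using le by (rule puiseux_ge_mono)
      have "real (Suc n) * \<delta> \<le> real (Suc (Suc n)) * \<delta>" using \<delta> by (intro mult_right_mono) auto
      from puiseux_ge_mono[OF z this] have b: "z l - s (Suc n) l \<in> puiseux_ge (real (Suc n) * \<delta>)" .
      from puiseux_ge_diff[OF a b] show ?thesis by simp
    qed
    then show ?thesis using puiseux_ge_all_imp_0[OF \<delta>, of "T z l - z l"] by simp
  qed
  have root: "\<Phi> z j = 0" for j
  proof -
    \<comment> \<open>The fixed point equation says that \<open>D'\<close> annihilates \<Phi> at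
      \<open>z\<close>; multiplying by \<open>C'\<close> recovers \<Phi> itself.\<close>
    have D\<Phi>: "(\<Sum>k\<in>UNIV. D' l k * \<Phi> z k) = 0" for l using fixed[of l] by (simp add: T_def)
    have "\<Phi> z j = (\<Sum>k\<in>UNIV. if j = k then \<Phi> z k else 0)" by simp
    also have "\<dots> = (\<Sum>k\<in>UNIV. (\<Sum>l\<in>UNIV. C' j l * D' l k) * \<Phi> z k)"
      unfolding CD by (intro sum.cong) auto
    also have "\<dots> = (\<Sum>l\<in>UNIV. C' j l * (\<Sum>k\<in>UNIV. D' l k * \<Phi> z k))"
      unfolding sum_distrib_left sum_distrib_right by (subst sum.swap) (simp add: mult.assoc)
    also have "\<dots> = 0" by (simp add: D\<Phi>)
    finally show ?thesis .
  qed
  show ?thesis using \<delta> z_ge root unfolding \<Phi>_def E_def by blast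
qed

section \<open>Uniqueness\<close>

lemma puiseux_leads_minus_1:
  assumes "puiseux_leads x e c"
  shows "e > 0 \<Longrightarrow> puiseux_leads (x - 1) 0 (- 1)"
    and "e < 0 \<Longrightarrow> puiseux_leads (x - 1) e c"
    and "e = 0 \<Longrightarrow> puiseux_leads (x - 1) 0 (c - 1)"
  using assms by (auto simp: puiseux_leads_def puiseux_coeff_simps)

lemma puiseux_leads_times_const:
  "puiseux_leads x e c \<Longrightarrow> puiseux_leads (x * puiseux_const d) e (c * d)"
  using puiseux_leads_mult[OF _ puiseux_leads_const, of x e c d] by simp

text \<open>The difference of the two systems, paired with \<open>w\<close>, is a vanishing sum of elements that are
  zero or positive.\<close>

lemma puiseux_critical_pairing:
  fixes v :: "'i \<Rightarrow> int ^ 'r::finite" and w :: "'r \<Rightarrow> complex"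
  assumes N: "finite N" and g: "\<And>i. i \<in> N \<Longrightarrow> g i \<in> puiseux_pos"
    and crit: "\<And>j. (\<Sum>i\<in>N. g i * of_int (v i $ j)) = 0"
    and critY: "\<And>j. (\<Sum>i\<in>N. g i * Y i * of_int (v i $ j)) = 0"
    and pos: "\<And>i. i \<in> N \<Longrightarrow> (\<Sum>j\<in>UNIV. of_int (v i $ j) * w j) \<noteq> 0 \<Longrightarrow>
      (Y i - 1) * puiseux_const (\<Sum>j\<in>UNIV. of_int (v i $ j) * w j) \<in> puiseux_pos"
    and i: "i \<in> N"
  shows "(\<Sum>j\<in>UNIV. of_int (v i $ j) * w j) = 0"
proof -
  define c where "c i = (\<Sum>j\<in>UNIV. of_int (v i $ j) * w j)" for i
  define f where "f i = g i * ((Y i - 1) * puiseux_const (c i))" for i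
  have "sum f N = (\<Sum>i\<in>N. \<Sum>j\<in>UNIV. puiseux_const (w j) * (g i * Y i * of_int (v i $ j) - g i * of_int (v i $ j)))"
    unfolding f_def c_def puiseux_const_sum puiseux_const_mult puiseux_const_of_int sum_distrib_left
    by (simp add: algebra_simps)
  also have "\<dots> = (\<Sum>j\<in>UNIV. puiseux_const (w j) *
      ((\<Sum>i\<in>N. g i * Y i * of_int (v i $ j)) - (\<Sum>i\<in>N. g i * of_int (v i $ j))))"
    by (subst sum.swap) (simp add: sum_distrib_left sum_subtractf right_diff_distrib)
  also have "\<dots> = 0" using crit critY by simp
  finally have "sum f N = 0" .
  moreover have f: "f i \<in> puiseux_pos" if "i \<in> N" "c i \<noteq> 0" for i
    using puiseux_pos_mult[OF g pos, of i i] that unfolding f_def c_def by blast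
  moreover have "f i = 0 \<or> f i \<in> puiseux_pos" if "i \<in> N" for i
    using f[OF that] by (cases "c i = 0") (auto simp: f_def)
  ultimately have "f i = 0" using puiseux_pos_sum_eq_0[OF N _ _ i, of f] by blast
  then show ?thesis using f[OF i] puiseux_pos_nonzero unfolding c_def by blast
qed

text \<open>Here \<open>g i\<close> are the terms at one critical point, and the monomials in
  \<open>y\<close> are the factors to the terms at the other. By \<open>sp\<close> a real vector
  whose pairings with all exponents vanish is zero.\<close>

lemma puiseux_critical_unique:
  fixes v :: "'i \<Rightarrow> int ^ 'r::finite" and y :: "'r \<Rightarrow> puiseux"
  assumes N: "finite N" and g: "\<And>i. i \<in> N \<Longrightarrow> g i \<in> puiseux_pos"
    and y: "\<And>j. y j \<in> puiseux_pos"
    and crit: "\<And>j. (\<Sum>i\<in>N. g i * of_int (v i $ j)) = 0"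
    and critY: "\<And>j. (\<Sum>i\<in>N. g i * (\<Prod>l\<in>UNIV. y l powi (v i $ l)) * of_int (v i $ j)) = 0"
    and sp: "\<And>w :: 'r \<Rightarrow> real. (\<And>i. i \<in> N \<Longrightarrow> (\<Sum>j\<in>UNIV. of_int (v i $ j) * w j) = 0) \<Longrightarrow> w = (\<lambda>_. 0)"
  shows "y j = 1"
proof -
  define Y where "Y i = (\<Prod>l\<in>UNIV. y l powi (v i $ l))" for i
  note pairing = puiseux_critical_pairing[OF N g crit critY[folded Y_def]]
  have "\<exists>e c. c > 0 \<and> puiseux_leads (y j) e (of_real c)" for j
    using y by (simp add: puiseux_pos_iff)
  then obtain e c where c: "\<And>j. c j > 0" and ec: "\<And>j. puiseux_leads (y j) (e j) (of_real (c j))"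
    by metis
  define C where "C i = (\<Prod>j\<in>UNIV. c j powi (v i $ j))" for i
  define s where "s i = (\<Sum>j\<in>UNIV. of_int (v i $ j) * e j)" for i
  have C: "C i > 0" for i unfolding C_def using c by (intro prod_pos) simp
  have Ylead: "puiseux_leads (Y i) (s i) (of_real (C i))" for i
  proof -
    have "puiseux_leads (y j powi n) (of_int n * e j) (of_real (c j) powi n)" for j n
      using c[of j] by (intro puiseux_leads_power_int ec) simp
    then have "puiseux_leads (Y i) (s i) (\<Prod>j\<in>UNIV. of_real (c j) powi (v i $ j))"
      unfolding Y_def s_def by (intro puiseux_leads_prod)
    then show ?thesis by (simp add: C_def)
  qed
  \<comment> \<open>\<open>Y i - 1\<close> has leading coefficient -1 if \<open>s i > 0\<close> and
    \<open>C i > 0\<close> if \<open>s i < 0\<close>, so in both cases its product with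
    \<open>- s i\<close> is positive.\<close>
  have "s i = 0" if "i \<in> N" for i
  proof -
    have eq: "(\<Sum>j\<in>UNIV. of_int (v i $ j) * complex_of_real (- e j)) = of_real (- s i)" for i
      by (simp add: s_def sum_negf)
    have "(\<Sum>j\<in>UNIV. of_int (v i $ j) * complex_of_real (- e j)) = 0"
    proof (rule pairing[OF _ _ that])
      fix i
      assume "(\<Sum>j\<in>UNIV. of_int (v i $ j) * complex_of_real (- e j)) \<noteq> 0"
      then have "s i \<noteq> 0" unfolding eq by simp
      then consider "s i > 0" | "s i < 0" by linarith
      then show "(Y i - 1) * puiseux_const (\<Sum>j\<in>UNIV. of_int (v i $ j) * complex_of_real (- e j)) \<in> puiseux_pos"
        unfolding eq
      proof cases
        case 1
        from puiseux_leads_times_const[OF puiseux_leads_minus_1(1)[OF Ylead 1], of "of_real (- s i)"]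
        show "(Y i - 1) * puiseux_const (of_real (- s i)) \<in> puiseux_pos"
          unfolding puiseux_pos_iff using 1 by (intro exI[of _ 0] exI[of _ "s i"]) simp
      next
        case 2
        from puiseux_leads_times_const[OF puiseux_leads_minus_1(2)[OF Ylead 2], of "of_real (- s i)"]
        show "(Y i - 1) * puiseux_const (of_real (- s i)) \<in> puiseux_pos"
          unfolding puiseux_pos_iff using 2 C[of i]
          by (intro exI[of _ "s i"] exI[of _ "C i * (- s i)"] conjI mult_pos_pos)
            (simp_all only: of_real_mult neg_0_less_iff_less)
      qed
    qed
    then show ?thesis unfolding eq by simp
  qed
  then have e0: "e j = 0" for j using sp[of e] by (simp add: s_def)
  then have s0: "s i = 0" for i by (simp add: s_def)
  define q where "q i = (\<Sum>j\<in>UNIV. of_int (v i $ j) * ln (c j))" for i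
  have Cq: "C i = exp (q i)" for i
  proof -
    have "c j powi n = exp (of_int n * ln (c j))" for j n
      using c[of j] by (simp add: powr_real_of_int' [symmetric] powr_def)
    then show ?thesis by (simp add: C_def q_def exp_sum)
  qed
  \<comment> \<open>All orders being 0, the coefficient of \<open>Y i - 1\<close> at 0 is
    \<open>exp (q i) - 1\<close>, which has the sign of \<open>q i\<close>.\<close>
  have "q i = 0" if "i \<in> N" for i
  proof -
    have eq: "(\<Sum>j\<in>UNIV. of_int (v i $ j) * complex_of_real (ln (c j))) = of_real (q i)" for i
      by (simp add: q_def)
    have "(\<Sum>j\<in>UNIV. of_int (v i $ j) * complex_of_real (ln (c j))) = 0"
    proof (rule pairing[OF _ _ that])
      fix i
      assume "(\<Sum>j\<in>UNIV. of_int (v i $ j) * complex_of_real (ln (c j))) \<noteq> 0"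
      then have "q i \<noteq> 0" unfolding eq by simp
      then have pos: "(exp (q i) - 1) * q i > 0" by (cases "q i > 0") (auto simp: mult_neg_neg)
      from puiseux_leads_times_const[OF puiseux_leads_minus_1(3)[OF Ylead s0], of i "of_real (q i)"]
      show "(Y i - 1) * puiseux_const (\<Sum>j\<in>UNIV. of_int (v i $ j) * complex_of_real (ln (c j))) \<in> puiseux_pos"
        unfolding eq puiseux_pos_iff using pos
        by (intro exI[of _ 0] exI[of _ "(exp (q i) - 1) * q i"]) (simp add: Cq)
    qed
    then show ?thesis unfolding eq by simp
  qed
  then have "(\<lambda>j. ln (c j)) = (\<lambda>_. 0)" by (intro sp) (simp add: q_def)
  then have c1: "c j = 1" for j using c[of j] by (metis ln_eq_zero_iff)
  define z where "z j = y j - 1" for j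
  have z: "puiseux_leads (z j) 0 0" for j
    using puiseux_leads_minus_1(3)[OF ec e0] by (simp add: z_def c1)
  have "z j = 0" for j
  proof (rule ccontr)
    assume "z j \<noteq> 0"
    define A where "A = {j. z j \<noteq> 0}"
    have "\<exists>a b. puiseux_leads (z j) a b \<and> b \<noteq> 0" if "j \<in> A" for j
      using that puiseux_leads_exists[of "z j"] unfolding A_def by blast
    then obtain a b where ab: "\<And>j. j \<in> A \<Longrightarrow> puiseux_leads (z j) (a j) (b j) \<and> b j \<noteq> 0" by metis
    \<comment> \<open>\<open>m\<close> is the least order of a nonzero \<open>z j\<close>. The
      coefficients \<open>d j\<close> at \<open>m\<close> may vanish for some \<open>j\<close>, but
      not for the index \<open>k\<close> attaining \<open>m\<close>.\<close>
    define m where "m = Min (a ` A)"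
    have "m \<in> a ` A" unfolding m_def using \<open>z j \<noteq> 0\<close> by (intro Min_in) (auto simp: A_def)
    then obtain k where k: "k \<in> A" "m = a k" by blast
    have m: "m \<le> a j" if "j \<in> A" for j unfolding m_def using that by (intro Min_le) auto
    have z_ge: "z j \<in> puiseux_ge m" for j
      using puiseux_leads_ge[OF conjunct1[OF ab] m] by (cases "j \<in> A") (auto simp: A_def)
    have "m > 0"
    proof (rule ccontr)
      assume "\<not> m > 0"
      then have "puiseux_coeff (z k) m = 0"
        using z[of k] by (cases "m = 0") (auto simp: puiseux_leads_def)
      then show False using ab[OF k(1)] k(2) by (auto simp: puiseux_leads_def)
    qed
    define d where "d j = puiseux_coeff (z j) m" for j
    have dk: "d k \<noteq> 0" using ab[OF k(1)] k(2) by (auto simp: puiseux_leads_def d_def)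
    define S where "S i = (\<Sum>j\<in>UNIV. of_int (v i $ j) * d j)" for i
    \<comment> \<open>\<open>Y i - 1\<close> agrees with its linear part below order
      \<open>m + m\<close>, which exceeds \<open>m\<close>; so its coefficient at \<open>m\<close>
      is linear in \<open>d\<close>.\<close>
    have lead: "puiseux_leads (Y i - 1) m (S i)" for i
    proof -
      define L where "L = (\<Sum>l\<in>UNIV. of_int (v i $ l) * z l)"
      have "puiseux_tangent m m (\<Prod>l\<in>UNIV. (1 + z l) powi (v i $ l)) (\<Prod>l\<in>UNIV. (1 + 0) powi (v i $ l))
        (\<Sum>l\<in>UNIV. of_int (v i $ l) * (z l - 0))"
        using z_ge \<open>m > 0\<close> by (intro puiseux_tangent_monomial) auto
      then have "Y i - 1 - L \<in> puiseux_ge (m + m)" "L \<in> puiseux_ge m"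
        by (simp_all add: puiseux_tangent_def z_def Y_def L_def)
      then have "puiseux_coeff (Y i - 1) \<mu> = puiseux_coeff L \<mu>" if "\<mu> \<le> m" for \<mu>
        using that \<open>m > 0\<close> by (auto simp: puiseux_ge_def puiseux_coeff_diff)
      moreover have "puiseux_coeff L m = S i"
        by (simp add: L_def S_def d_def puiseux_coeff_sum puiseux_coeff_const_times
            flip: puiseux_const_of_int)
      ultimately show ?thesis using \<open>L \<in> puiseux_ge m\<close> by (simp add: puiseux_leads_def puiseux_ge_def)
    qed
    have S0: "S i = 0" if "i \<in> N" for i
    proof -
      \<comment> \<open>Pairing with the conjugates produces the coefficient
        \<open>S i * cnj (S i)\<close>, a squared modulus.\<close>
      have eq: "(\<Sum>j\<in>UNIV. of_int (v i $ j) * cnj (d j)) = cnj (S i)" for i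
        by (simp add: S_def)
      have "(\<Sum>j\<in>UNIV. of_int (v i $ j) * cnj (d j)) = 0"
      proof (rule pairing[OF _ _ that])
        fix i
        assume "(\<Sum>j\<in>UNIV. of_int (v i $ j) * cnj (d j)) \<noteq> 0"
        then have "S i \<noteq> 0" unfolding eq by simp
        then have "(cmod (S i))\<^sup>2 > 0" by simp
        moreover have "puiseux_leads ((Y i - 1) * puiseux_const (cnj (S i))) m (of_real ((cmod (S i))\<^sup>2))"
          unfolding complex_norm_square by (rule puiseux_leads_times_const[OF lead])
        ultimately show "(Y i - 1) * puiseux_const (\<Sum>j\<in>UNIV. of_int (v i $ j) * cnj (d j)) \<in> puiseux_pos"
          unfolding eq puiseux_pos_iff by blast
      qed
      then show ?thesis unfolding eq by simp
    qed
    \<comment> \<open>\<open>sp\<close> concerns real vectors, so it is applied to real and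
      imaginary parts.\<close>
    have "(\<Sum>j\<in>UNIV. of_int (v i $ j) * Re (d j)) = 0" "(\<Sum>j\<in>UNIV. of_int (v i $ j) * Im (d j)) = 0"
      if "i \<in> N" for i
      using arg_cong[OF S0[OF that], of Re] arg_cong[OF S0[OF that], of Im] by (simp_all add: S_def)
    then have "(\<lambda>j. Re (d j)) = (\<lambda>_. 0)" "(\<lambda>j. Im (d j)) = (\<lambda>_. 0)" by (intro sp; simp)+
    then have "d k = 0" by (metis complex_eq_iff zero_complex.simps)
    then show False using dk by simp
  qed
  then show ?thesis by (simp add: z_def)
qed

section \<open>Existence\<close>

text \<open>Otherwise the hull lies in the half-space where the pairing with \<open>w\<close> is at
  most 0, although it contains a small positive multiple of \<open>w\<close>.\<close>

lemma interior_convex_hull_imp_positive: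
  fixes S :: "'a::euclidean_space set"
  assumes "0 \<in> interior (convex hull S)" "w \<noteq> 0"
  shows "\<exists>x\<in>S. x \<bullet> w > 0"
proof (rule ccontr)
  assume "\<not> (\<exists>x\<in>S. x \<bullet> w > 0)"
  then have "convex hull S \<subseteq> {x. w \<bullet> x \<le> 0}"
    by (intro hull_minimal convex_halfspace_le) (auto simp: inner_commute not_less)
  moreover obtain e where e: "e > 0" "ball 0 e \<subseteq> convex hull S"
    using assms(1) by (auto simp: mem_interior)
  moreover have "(e / 2 / norm w) *\<^sub>R w \<in> ball 0 e" using e(1) assms(2) by simp
  ultimately have "w \<bullet> ((e / 2 / norm w) *\<^sub>R w) \<le> 0" by blast
  then have "e / 2 / norm w * (w \<bullet> w) \<le> 0" by simp
  moreover have "e / 2 / norm w * (w \<bullet> w) > 0" using e(1) assms(2) by simp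
  ultimately show False by simp
qed

section \<open>Evaluation of Laurent polynomials and the critical point equations\<close>

lemma laurent_eval_superset:
  assumes "finite A" "Poly_Mapping.keys W \<subseteq> A"
  shows "laurent_eval W x = (\<Sum>v\<in>A. Poly_Mapping.lookup W v * (\<Prod>j\<in>UNIV. (x $ j) powi (v $ j)))"
  unfolding laurent_eval_def using assms
  by (intro sum.mono_neutral_left) (auto simp: in_keys_iff)

text \<open>Keys can cancel in a sum, so all three polynomials are evaluated over the union of the
  key sets.\<close>

lemma laurent_eval_add: "laurent_eval (V + W) x = laurent_eval V x + laurent_eval W x"
proof -
  let ?A = "Poly_Mapping.keys V \<union> Poly_Mapping.keys W"
  have "Poly_Mapping.keys (V + W) \<subseteq> ?A" by (rule keys_add)
  then show ?thesis
    by (simp add: laurent_eval_superset[of ?A] lookup_add distrib_right sum.distrib)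
qed

lemma laurent_eval_sum: "laurent_eval (\<Sum>i\<in>A. f i) x = (\<Sum>i\<in>A. laurent_eval (f i) x)"
  by (induction A rule: infinite_finite_induct) (simp_all add: laurent_eval_add, simp_all add: laurent_eval_def)

lemma laurent_eval_single:
  "laurent_eval (Poly_Mapping.single v c) x = c * (\<Prod>j\<in>UNIV. (x $ j) powi (v $ j))"
  by (simp add: laurent_eval_superset[of "{v}"])

lemma lookup_sum_single:
  assumes "finite A" "inj_on v A" "i \<in> A"
  shows "Poly_Mapping.lookup (\<Sum>i\<in>A. Poly_Mapping.single (v i) (c i)) (v i) = c i"
proof -
  have "Poly_Mapping.lookup (\<Sum>k\<in>A. Poly_Mapping.single (v k) (c k)) (v i)
      = (\<Sum>k\<in>A. if k = i then c i else 0)"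
    unfolding lookup_sum using assms by (intro sum.cong) (auto simp: lookup_single inj_on_eq_iff)
  then show ?thesis using assms by simp
qed

lemma keys_sum_single:
  assumes "finite A" "inj_on v A" "\<And>i. i \<in> A \<Longrightarrow> c i \<noteq> 0"
  shows "Poly_Mapping.keys (\<Sum>i\<in>A. Poly_Mapping.single (v i) (c i)) = v ` A"
proof
  show "Poly_Mapping.keys (\<Sum>i\<in>A. Poly_Mapping.single (v i) (c i)) \<subseteq> v ` A"
    by (rule order_trans[OF keys_sum]) auto
  show "v ` A \<subseteq> Poly_Mapping.keys (\<Sum>i\<in>A. Poly_Mapping.single (v i) (c i))"
    using assms by (auto simp: in_keys_iff lookup_sum_single)
qed

lemma prod_powi_diff_axis:
  fixes x :: "'a::field ^ 'r::finite"
  assumes "x $ j \<noteq> 0"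
  shows "x $ j * (\<Prod>l\<in>UNIV. (x $ l) powi ((v - axis j 1) $ l)) = (\<Prod>l\<in>UNIV. (x $ l) powi (v $ l))"
proof -
  have "(x $ l) powi ((v - axis j 1) $ l) = (x $ l) powi (v $ l)" if "l \<noteq> j" for l
    using that by (simp add: axis_def)
  then have "(\<Prod>l\<in>UNIV - {j}. (x $ l) powi ((v - axis j 1) $ l)) = (\<Prod>l\<in>UNIV - {j}. (x $ l) powi (v $ l))"
    by (intro prod.cong) auto
  moreover have "x $ j * (x $ j) powi ((v - axis j 1) $ j) = (x $ j) powi (v $ j)"
    using assms by (simp add: axis_def power_int_diff)
  ultimately show ?thesis
    by (simp add: prod.remove[of UNIV j] mult.assoc[symmetric])
qed

text \<open>Multiplying the \<open>j\<close>th derivative by the nonzero \<open>x $ j\<close> undoes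
  the shift of exponents and gives the logarithmic derivative, the terms of the polynomial weighted
  by \<open>v i $ j\<close>.\<close>

lemma critical_point_sum_single_iff:
  fixes x :: "'a::field ^ 'r::finite"
  assumes "finite A" "inj_on v A" "\<And>i. i \<in> A \<Longrightarrow> c i \<noteq> 0" and x: "\<And>j. x $ j \<noteq> 0"
  shows "critical_point (\<Sum>i\<in>A. Poly_Mapping.single (v i) (c i)) x \<longleftrightarrow>
    (\<forall>j. (\<Sum>i\<in>A. c i * (\<Prod>l\<in>UNIV. (x $ l) powi (v i $ l)) * of_int (v i $ j)) = 0)"
proof -
  let ?W = "\<Sum>i\<in>A. Poly_Mapping.single (v i) (c i)"
  have keys: "Poly_Mapping.keys ?W = v ` A" using assms(1-3) by (rule keys_sum_single)
  have "x $ j * laurent_eval (laurent_pderiv j ?W) x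
      = (\<Sum>i\<in>A. c i * (\<Prod>l\<in>UNIV. (x $ l) powi (v i $ l)) * of_int (v i $ j))" for j
  proof -
    have "laurent_eval (laurent_pderiv j ?W) x =
      (\<Sum>i\<in>A. of_int (v i $ j) * c i * (\<Prod>l\<in>UNIV. (x $ l) powi ((v i - axis j 1) $ l)))"
      unfolding laurent_pderiv_def keys sum.reindex[OF assms(2)] o_def
        laurent_eval_sum laurent_eval_single
      using assms by (intro sum.cong) (simp_all add: lookup_sum_single)
    also have "x $ j * \<dots> = (\<Sum>i\<in>A. of_int (v i $ j) * c i * (x $ j * (\<Prod>l\<in>UNIV. (x $ l) powi ((v i - axis j 1) $ l))))"
      by (simp add: sum_distrib_left mult_ac)
    finally show ?thesis unfolding prod_powi_diff_axis[OF x] by (simp add: mult_ac)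
  qed
  from this[symmetric] show ?thesis by (simp add: critical_point_def x)
qed

section \<open>Lifting the initial term to a critical point\<close>

lemma puiseux_critical_exists:
  fixes v :: "'i \<Rightarrow> int ^ 'r::finite" and \<gamma> :: "'i \<Rightarrow> puiseux"
  assumes N: "finite N" and \<gamma>: "\<And>i. i \<in> N \<Longrightarrow> \<gamma> i \<in> puiseux_pos"
    and sp: "\<And>w :: real ^ 'r. w \<noteq> 0 \<Longrightarrow> \<exists>i\<in>N. (\<chi> j. of_int (v i $ j)) \<bullet> w > 0"
  shows "\<exists>x :: 'r \<Rightarrow> puiseux. (\<forall>j. x j \<in> puiseux_pos) \<and>
    (\<forall>j. (\<Sum>i\<in>N. \<gamma> i * (\<Prod>l\<in>UNIV. x l powi (v i $ l)) * of_int (v i $ j)) = 0)"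
proof -
  define u :: "'i \<Rightarrow> real ^ 'r" where "u i = (\<chi> j. of_int (v i $ j))" for i
  have u_inner: "u i \<bullet> w = (\<Sum>j\<in>UNIV. of_int (v i $ j) * w $ j)" for i w
    by (simp add: u_def inner_vec_def)
  have "\<exists>\<mu> \<alpha>. i \<in> N \<longrightarrow> \<alpha> > 0 \<and> puiseux_leads (\<gamma> i) \<mu> (of_real \<alpha>)" for i
    using \<gamma> by (auto simp: puiseux_pos_iff)
  then obtain \<mu> \<alpha> where \<alpha>: "\<And>i. i \<in> N \<Longrightarrow> \<alpha> i > 0"
    and lead: "\<And>i. i \<in> N \<Longrightarrow> puiseux_leads (\<gamma> i) (\<mu> i) (of_real (\<alpha> i))" by metis
  have "\<exists>d l B \<kappa>. tropical_flag N u \<mu> \<alpha> UNIV d l B \<kappa> \<and>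
    (\<forall>m. (\<forall>i\<in>N. (\<exists>w\<in>UNIV. u i \<bullet> w \<noteq> 0) \<longrightarrow> m < \<mu> i) \<longrightarrow>
         (\<forall>i\<in>N. (\<exists>w\<in>UNIV. u i \<bullet> w \<noteq> 0) \<longrightarrow> m < \<mu> i + u i \<bullet> d))"
    by (rule tropical_flag_exists[OF N]) (simp_all add: \<alpha> sp u_def)
  then obtain d l B \<kappa> where flag: "tropical_flag N u \<mu> \<alpha> UNIV d l B \<kappa>" by blast
  have B: "independent B" "span B = UNIV" using flag by (simp_all add: tropical_flag_def)
  \<comment> \<open>Indexing the basis by the variables gives the system the square shape required
    by Hensel's lemma.\<close>
  have "card B = CARD('r)" using basis_card_eq_dim[of B UNIV] B by simp
  moreover have "finite B" using B(1) by (rule independent_imp_finite)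
  ultimately obtain b where b: "bij_betw b (UNIV :: 'r set) B"
    using finite_same_card_bij[of "UNIV :: 'r set" B] by auto
  have bB: "b j \<in> B" for j using b by (auto simp: bij_betw_def)
  define \<nu> where "\<nu> i = \<mu> i + u i \<bullet> d" for i
  define a where "a i = \<alpha> i * exp (u i \<bullet> l)" for i
  define k where "k j = \<kappa> (b j)" for j
  have low: "u i \<bullet> b j = 0" if "i \<in> N" "\<nu> i < k j" for i j
    using flag that bB unfolding tropical_flag_def \<nu>_def k_def by blast
  have bal: "(\<Sum>i | i \<in> N \<and> \<nu> i = k j. a i * (u i \<bullet> b j)) = 0" for j
    using flag bB[of j] unfolding tropical_flag_def \<nu>_def k_def a_def by blast
  have inj: "w = 0" if w: "\<And>j. (\<Sum>i | i \<in> N \<and> \<nu> i = k j. a i * (u i \<bullet> b j) * (u i \<bullet> w)) = 0" for w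
  proof -
    have "(\<Sum>i | i \<in> N \<and> \<mu> i + u i \<bullet> d = \<kappa> b'. \<alpha> i * exp (u i \<bullet> l) * (u i \<bullet> b') * (u i \<bullet> w)) = 0"
      if b': "b' \<in> B" for b'
    proof -
      obtain j where "b' = b j" using b b' by (auto simp: bij_betw_def)
      then show ?thesis using w[of j] by (simp add: \<nu>_def k_def a_def)
    qed
    then show ?thesis using flag unfolding tropical_flag_def by blast
  qed
  define X where "X j = puiseux_monom (of_real (exp (l $ j))) (d $ j)" for j
  have Xlead: "puiseux_leads (X j) (d $ j) (of_real (exp (l $ j)))" for j
    by (simp add: X_def puiseux_leads_def puiseux_coeff_simps)
  \<comment> \<open>The terms at the initial point \<open>X\<close>; the flag controls their orders
    \<open>\<nu> i\<close> and leading coefficients \<open>a i\<close>.\<close>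
  define G where "G i = \<gamma> i * (\<Prod>j\<in>UNIV. X j powi (v i $ j))" for i
  have Glead: "puiseux_leads (G i) (\<nu> i) (of_real (a i))" if "i \<in> N" for i
  proof -
    have "puiseux_leads (X j powi n) (of_int n * d $ j) (of_real (exp (l $ j)) powi n)" for j n
      by (intro puiseux_leads_power_int Xlead) simp
    then have "puiseux_leads (\<Prod>j\<in>UNIV. X j powi (v i $ j)) (\<Sum>j\<in>UNIV. of_int (v i $ j) * d $ j)
        (\<Prod>j\<in>UNIV. of_real (exp (l $ j)) powi (v i $ j))"
      by (intro puiseux_leads_prod)
    moreover have "(\<Prod>j\<in>UNIV. of_real (exp (l $ j)) powi (v i $ j)) = complex_of_real (exp (u i \<bullet> l))"
    proof -
      have "exp (u i \<bullet> l) = (\<Prod>j\<in>UNIV. exp (l $ j) powi (v i $ j))"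
        unfolding u_inner by (simp add: exp_sum exp_power_int)
      then show ?thesis by simp
    qed
    ultimately have "puiseux_leads (\<Prod>j\<in>UNIV. X j powi (v i $ j)) (u i \<bullet> d) (of_real (exp (u i \<bullet> l)))"
      by (simp add: u_inner)
    from puiseux_leads_mult[OF lead[OF that] this] show ?thesis by (simp add: G_def \<nu>_def a_def)
  qed
  \<comment> \<open>The equation in direction \<open>b j\<close>, divided by t to the power
    \<open>k j\<close>. By \<open>low\<close> the terms of smaller order are absent, so
    \<open>h\<close> has order at least 0 and only terms of order exactly \<open>k j\<close> can
    have a nonzero residue.\<close>
  define h where "h i j = puiseux_monom (of_real (u i \<bullet> b j)) (- k j) * G i" for i j
  have h: "h i j \<in> puiseux_ge 0"
    "puiseux_coeff (h i j) 0 = (if \<nu> i = k j then of_real (a i * (u i \<bullet> b j)) else 0)" if "i \<in> N" for i j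
  proof -
    have "puiseux_leads (puiseux_monom (of_real (u i \<bullet> b j)) (- k j)) (- k j) (of_real (u i \<bullet> b j))"
      by (simp add: puiseux_leads_def puiseux_coeff_simps)
    from puiseux_leads_mult[OF this Glead[OF that]]
    have lead: "puiseux_leads (h i j) (\<nu> i - k j) (of_real (a i * (u i \<bullet> b j)))"
      by (simp add: h_def mult.commute)
    have zero: "h i j = 0" if "\<nu> i < k j"
      by (rule puiseux_eqI) (simp add: h_def low[OF \<open>i \<in> N\<close> that] puiseux_coeff_simps)
    show "h i j \<in> puiseux_ge 0"
      using zero puiseux_leads_ge[OF lead, of 0] by (cases "\<nu> i < k j") auto
    show "puiseux_coeff (h i j) 0 = (if \<nu> i = k j then of_real (a i * (u i \<bullet> b j)) else 0)"
      using zero lead by (cases "\<nu> i" "k j" rule: linorder_cases) (auto simp: puiseux_leads_def puiseux_coeff_simps)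
  qed
  have sum_h: "(\<Sum>i\<in>N. puiseux_coeff (h i j) 0 * f i) = (\<Sum>i | i \<in> N \<and> \<nu> i = k j. of_real (a i * (u i \<bullet> b j)) * f i)"
    for j f
  proof -
    have "(\<Sum>i\<in>N. puiseux_coeff (h i j) 0 * f i)
        = (\<Sum>i\<in>N. if \<nu> i = k j then of_real (a i * (u i \<bullet> b j)) * f i else 0)"
      by (intro sum.cong) (simp_all add: h(2))
    also have "\<dots> = (\<Sum>i | i \<in> N \<and> \<nu> i = k j. of_real (a i * (u i \<bullet> b j)) * f i)"
      by (rule sum.inter_filter[OF N, symmetric])
    finally show ?thesis .
  qed
  have res: "(\<Sum>i\<in>N. puiseux_coeff (h i j) 0) = 0" for j
    using sum_h[of j "\<lambda>_. 1"] arg_cong[OF bal[of j], of complex_of_real] by simp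
  define J :: "complex ^ 'r ^ 'r" where
    "J = (\<chi> j m. \<Sum>i\<in>N. puiseux_coeff (h i j) 0 * of_int (v i $ m))"
  \<comment> \<open>The flag gives injectivity on real vectors. All coefficients of the system are
    real, so it applies to the real and imaginary parts of \<open>w\<close>.\<close>
  have "w = 0" if w: "J *v w = 0" for w
  proof -
    have eq: "(\<Sum>i | i \<in> N \<and> \<nu> i = k j. of_real (a i * (u i \<bullet> b j)) * (\<Sum>m\<in>UNIV. of_int (v i $ m) * w $ m)) = 0" for j
    proof -
      have "0 = (J *v w) $ j" using w by simp
      also have "\<dots> = (\<Sum>m\<in>UNIV. \<Sum>i\<in>N. puiseux_coeff (h i j) 0 * (of_int (v i $ m) * w $ m))"
        by (simp add: matrix_vector_mult_def J_def sum_distrib_right mult.assoc)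
      also have "\<dots> = (\<Sum>i\<in>N. puiseux_coeff (h i j) 0 * (\<Sum>m\<in>UNIV. of_int (v i $ m) * w $ m))"
        unfolding sum_distrib_left by (rule sum.swap)
      finally show ?thesis unfolding sum_h by simp
    qed
    have "(\<chi> m. Re (w $ m)) = 0" "(\<chi> m. Im (w $ m)) = 0"
      using arg_cong[OF eq, of Re] arg_cong[OF eq, of Im]
      by (intro inj; simp add: u_inner)+
    then show "w = 0" by (simp add: vec_eq_iff complex_eq_iff)
  qed
  then have "invertible J"
    using matrix_left_invertible_ker[of J] by (auto simp: invertible_left_inverse)
  then have "\<exists>z. (\<exists>\<delta>>0. \<forall>l. z l \<in> puiseux_ge \<delta>) \<and>
    (\<forall>j. (\<Sum>i\<in>N. h i j * (\<Prod>l\<in>UNIV. (1 + z l) powi (v i $ l))) = 0)"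
    unfolding J_def using N h(1) res by (intro puiseux_hensel)
  then obtain z \<delta> where \<delta>: "\<delta> > 0" and z: "\<And>j. z j \<in> puiseux_ge \<delta>"
    and root: "\<And>j. (\<Sum>i\<in>N. h i j * (\<Prod>m\<in>UNIV. (1 + z m) powi (v i $ m))) = 0"
    by blast
  define x where "x j = X j * (1 + z j)" for j
  define t where "t i = \<gamma> i * (\<Prod>m\<in>UNIV. x m powi (v i $ m))" for i
  have t: "G i * (\<Prod>m\<in>UNIV. (1 + z m) powi (v i $ m)) = t i" for i
    by (simp add: G_def t_def x_def power_int_mult_distrib prod.distrib mult_ac)
  have eq: "(\<Sum>i\<in>N. puiseux_const (of_real (u i \<bullet> b j)) * t i) = 0" for j
  proof -
    have "h i j = puiseux_monom 1 (- k j) * (puiseux_const (of_real (u i \<bullet> b j)) * G i)" for i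
      by (simp add: h_def puiseux_const_def puiseux_monom_mult flip: mult.assoc)
    then have "puiseux_monom 1 (- k j) * (\<Sum>i\<in>N. puiseux_const (of_real (u i \<bullet> b j)) * t i) = 0"
      using root[of j] by (simp add: sum_distrib_left mult.assoc t)
    moreover have "puiseux_leads (puiseux_monom 1 (- k j)) (- k j) 1"
      by (simp add: puiseux_leads_def puiseux_coeff_simps)
    then have "puiseux_monom 1 (- k j) \<noteq> 0" using puiseux_leads_nonzero by fastforce
    ultimately show ?thesis by simp
  qed
  \<comment> \<open>The directions in which the paired equation holds form a real subspace. It
    contains \<open>B\<close>, hence the coordinate axes, which give the individual
    equations.\<close>
  define Z where "Z = {w. (\<Sum>i\<in>N. puiseux_const (of_real (u i \<bullet> w)) * t i) = 0}"
  have "subspace Z"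
  proof (rule subspaceI)
    show "x + y \<in> Z" if "x \<in> Z" "y \<in> Z" for x y
      using that by (simp add: Z_def inner_add_right puiseux_const_add distrib_right sum.distrib)
    show "c *\<^sub>R x \<in> Z" if "x \<in> Z" for c x
    proof -
      have "(\<Sum>i\<in>N. puiseux_const (of_real (u i \<bullet> c *\<^sub>R x)) * t i)
          = puiseux_const (of_real c) * (\<Sum>i\<in>N. puiseux_const (of_real (u i \<bullet> x)) * t i)"
        by (simp add: puiseux_const_mult sum_distrib_left mult.assoc)
      then show ?thesis using that by (simp add: Z_def)
    qed
  qed (simp add: Z_def)
  moreover have "B \<subseteq> Z" using b eq by (auto simp: bij_betw_def Z_def)
  ultimately have "Z = UNIV" using B(2) span_minimal by blast
  then have "axis j 1 \<in> Z" for j by blast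
  then have "(\<Sum>i\<in>N. t i * of_int (v i $ j)) = 0" for j
    by (simp add: Z_def inner_axis u_def puiseux_const_of_int mult.commute)
  moreover have "x j \<in> puiseux_pos" for j
  proof -
    have "puiseux_leads (1 + z j) 0 1" using z \<delta> by (intro puiseux_leads_one_plus) auto
    from puiseux_leads_mult[OF Xlead this] show ?thesis
      unfolding x_def puiseux_pos_iff by (intro exI[of _ "d $ j"] exI[of _ "exp (l $ j)"]) simp
  qed
  ultimately show ?thesis unfolding t_def by blast
qed

section \<open>Existence and uniqueness combined\<close>

theorem theorem1p1:
  fixes n :: nat
    and \<gamma> :: "nat \<Rightarrow> puiseux"
    and v :: "nat \<Rightarrow> int ^ 'r::finite"
    and W :: "('r, puiseux) laurent_poly"
  assumes distinct: "inj_on v {1..n}"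
    and W: "W = (\<Sum>i=1..n. Poly_Mapping.single (v i) (\<gamma> i))"
    and positivity: "\<And>i. i \<in> {1..n} \<Longrightarrow> \<gamma> i \<in> puiseux_pos"
    and full_dimensional: "aff_dim (newton_polytope W) = int CARD('r)"
    and zero_interior: "0 \<in> interior (newton_polytope W)"
  shows "\<exists>!x :: puiseux ^ 'r. (\<forall>j. x $ j \<in> puiseux_pos) \<and> critical_point W x"
proof -
  define N where "N = {1..n}"
  have N: "finite N" by (simp add: N_def)
  have \<gamma>: "\<gamma> i \<in> puiseux_pos" "\<gamma> i \<noteq> 0" if "i \<in> N" for i
    using positivity[of i] that puiseux_pos_nonzero by (auto simp: N_def)
  have inj: "inj_on v N" using distinct by (simp add: N_def)
  have WN: "W = (\<Sum>i\<in>N. Poly_Mapping.single (v i) (\<gamma> i))" using W by (simp add: N_def)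
  have keys: "Poly_Mapping.keys W = v ` N"
    unfolding WN using N inj \<gamma>(2) by (rule keys_sum_single)
  have span: "\<exists>i\<in>N. (\<chi> j. of_int (v i $ j)) \<bullet> w > 0" if "w \<noteq> 0" for w :: "real ^ 'r"
    using interior_convex_hull_imp_positive[OF zero_interior[unfolded newton_polytope_def keys] that] by auto
  have crit: "critical_point W x \<longleftrightarrow>
      (\<forall>j. (\<Sum>i\<in>N. \<gamma> i * (\<Prod>l\<in>UNIV. (x $ l) powi (v i $ l)) * of_int (v i $ j)) = 0)"
    if "\<forall>j. x $ j \<in> puiseux_pos" for x :: "puiseux ^ 'r"
    unfolding WN using that puiseux_pos_nonzero
    by (intro critical_point_sum_single_iff N inj \<gamma>(2)) auto
  have "\<exists>x :: 'r \<Rightarrow> puiseux. (\<forall>j. x j \<in> puiseux_pos) \<and>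
    (\<forall>j. (\<Sum>i\<in>N. \<gamma> i * (\<Prod>l\<in>UNIV. x l powi (v i $ l)) * of_int (v i $ j)) = 0)"
    using N \<gamma>(1) span by (rule puiseux_critical_exists)
  then obtain x where x: "\<And>j. x j \<in> puiseux_pos"
    "\<And>j. (\<Sum>i\<in>N. \<gamma> i * (\<Prod>l\<in>UNIV. x l powi (v i $ l)) * of_int (v i $ j)) = 0"
    by blast
  show ?thesis
  proof
    show "(\<forall>j. (\<chi> j. x j) $ j \<in> puiseux_pos) \<and> critical_point W (\<chi> j. x j)"
      using x crit[of "\<chi> j. x j"] by simp
  next
    fix x' :: "puiseux ^ 'r"
    assume x': "(\<forall>j. x' $ j \<in> puiseux_pos) \<and> critical_point W x'"
    \<comment> \<open>\<open>y\<close> is the quotient of the two critical points, so the terms at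
      \<open>x'\<close> are the terms \<open>g i\<close> at \<open>x\<close> times monomials in
      \<open>y\<close>.\<close>
    define g where "g i = \<gamma> i * (\<Prod>l\<in>UNIV. x l powi (v i $ l))" for i
    define y where "y j = x' $ j * inverse (x j)" for j
    have "y j = 1" for j
    proof (rule puiseux_critical_unique[OF N])
      show "g i \<in> puiseux_pos" if "i \<in> N" for i
        unfolding g_def using x(1) \<gamma>(1)[OF that]
        by (intro puiseux_pos_mult puiseux_pos_prod puiseux_pos_power_int)
      show "y j \<in> puiseux_pos" for j
        unfolding y_def using x(1) x' by (intro puiseux_pos_mult puiseux_pos_inverse) auto
      show "(\<Sum>i\<in>N. g i * of_int (v i $ j)) = 0" for j
        unfolding g_def by (rule x(2))
      have "x l * y l = x' $ l" for l
        using puiseux_pos_nonzero[OF x(1)] by (simp add: y_def)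
      then have "g i * (\<Prod>l\<in>UNIV. y l powi (v i $ l)) = \<gamma> i * (\<Prod>l\<in>UNIV. (x' $ l) powi (v i $ l))" for i
        by (simp add: g_def mult.assoc flip: prod.distrib power_int_mult_distrib)
      then show "(\<Sum>i\<in>N. g i * (\<Prod>l\<in>UNIV. y l powi (v i $ l)) * of_int (v i $ j)) = 0" for j
        using x' crit[of x'] by simp
      \<comment> \<open>A nonzero vector orthogonal to every exponent would contradict the strict
        inequality in \<open>span\<close>.\<close>
      show "w = (\<lambda>_. 0)" if w: "\<And>i. i \<in> N \<Longrightarrow> (\<Sum>j\<in>UNIV. of_int (v i $ j) * w j) = 0"
        for w :: "'r \<Rightarrow> real"
      proof -
        have "(\<chi> j. w j) = 0"
        proof (rule ccontr)
          assume "(\<chi> j. w j) \<noteq> 0"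
          from span[OF this] show False using w by (auto simp: inner_vec_def)
        qed
        then show ?thesis by (auto simp: vec_eq_iff)
      qed
    qed
    then have "x' $ j = x j" for j
      using puiseux_pos_nonzero[OF x(1)[of j]] by (simp add: y_def field_simps)
    then show "x' = (\<chi> j. x j)" by (simp add: vec_eq_iff)
  qed
qed

end
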